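(* Let $\delta>0$, let $V$, $U_N$, $H_N$, $\boldsymbol u^\pm$, $\boldsymbol u^s$, $S$, $B_\pm$, $\hat n$, $\lambda_j^s$, $\lambda_j^\pm$ be as defined in the context, with the concentration assumption stated there. Write $E_N^s=U_N(\boldsymbol u^s)$, $E_N^\pm=U_N(\boldsymbol u^\pm)$, and let $S_n=2\pi^{(n+1)/2}/\Gamma((n+1)/2)$ be the surface area of the $n$-dimensional unit sphere in $\mathbb{R}^{n+1}$. Then for every integer $N\ge2$, as $\beta\to\infty$, $$\int_S\max\big(\boldsymbol p\cdot\hat n,0\big)\,e^{-\beta H_N(\boldsymbol p,\boldsymbol u)}\,d\tilde\sigma(\boldsymbol p,\boldsymbol u)\ \sim\ \frac{2^{N-2}N^N(N-2)!\,S_{2N-3}}{\beta^N\prod_{j=2}^N\sqrt{\lambda_j^s}}\,e^{-\beta E_N^s},$$ where $d\tilde\sigma$ is the surface element on $S$, and $$C_N^\pm:=\int_{B_\pm}e^{-\beta H_N(\boldsymbol p,\boldsymbol u)}\,d\boldsymbol p\,d\boldsymbol u\ \sim\ \frac{2^{N-1}N^N(N-1)!\,S_{2N-1}}{\beta^N\prod_{j=1}^N\sqrt{\lambda_j^\pm}}\,e^{-\beta E_N^\pm}.$$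
   Context: $V:\mathbb{R}\to\mathbb{R}$ is a smooth double-well potential, bounded below, with $V(u)\ge Cu^2$ for some $C>0$ as $|u|\to\infty$. For $\boldsymbol p,\boldsymbol u\in\mathbb{R}^N$, $$U_N(\boldsymbol u)=\frac1N\sum_{j=1}^NV(u_j)+N\sum_{j=0}^N\tfrac12\delta^2(u_{j+1}-u_j)^2,\qquad H_N(\boldsymbol p,\boldsymbol u)=\frac1{2N}\sum_{j=1}^Np_j^2+U_N(\boldsymbol u),$$ with either Dirichlet ($u_0=u_{N+1}=0$) or Neumann ($u_0=u_1$, $u_{N+1}=u_N$) boundary conditions. Saddle: $\boldsymbol u^s$ is the Morse index 1 critical point of $U_N$ of minimum energy, so that $0=\delta^2N^2(u^s_{j-1}-2u^s_j+u^s_{j+1})-V'(u^s_j)$. The eigenvalues $\lambda_1^s<0<\lambda_2^s<\dots<\lambda_N^s$ and eigenvectors $\boldsymbol\phi^{(k)}$ solve $$\lambda_k^s\phi_j^{(k)}=-\delta^2N^2\big(\phi_{j-1}^{(k)}-2\phi_j^{(k)}+\phi_{j+1}^{(k)}\big)+V''(u_j^s)\phi_j^{(k)},\qquad j=1,\dots,N,$$ with the same boundary conditions (Dirichlet or Neumann) as $\boldsymbol u$. The dividing surface and the two regions are $$S=\{(\boldsymbol p,\boldsymbol u)\in\mathbb{R}^{2N}:(\boldsymbol u-\boldsymbol u^s)\cdot\boldsymbol\phi^{(1)}=0\},\quad B_\pm=\{(\boldsymbol p,\boldsymbol u)\in\mathbb{R}^{2N}:\pm(\boldsymbol u-\boldsymbol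 u^s)\cdot\boldsymbol\phi^{(1)}>0\},$$ and $\hat n=\boldsymbol\phi^{(1)}/|\boldsymbol\phi^{(1)}|\in\mathbb{R}^N$ is the unit normal to $\{\boldsymbol u:(\boldsymbol u-\boldsymbol u^s)\cdot\boldsymbol\phi^{(1)}=0\}$. Minimizers: $\boldsymbol u^+$ and $\boldsymbol u^-$ are the two minimizers of $U_N$, with $(\boldsymbol 0,\boldsymbol u^+)\in B_+$ and $(\boldsymbol 0,\boldsymbol u^-)\in B_-$ (each region contains exactly one). The eigenvalues $0<\lambda_1^\pm<\dots<\lambda_N^\pm$ solve $$\lambda_k^\pm\psi_j^{(k)\pm}=-\delta^2N^2\big(\psi_{j-1}^{(k)\pm}-2\psi_j^{(k)\pm}+\psi_{j+1}^{(k)\pm}\big)+V''(u_j^\pm)\psi_j^{(k)\pm},\qquad j=1,\dots,N,$$ with the same boundary conditions. Concentration assumption: the canonical measure is concentrated, up to exponentially small mass as $\beta\to\infty$, near $\boldsymbol u^s$ on $S$ and near $\boldsymbol u^\pm$ in $B_\pm$. That is, for every $\varepsilon>0$ there are $K,c,\beta_0>0$ such that for all $\beta>\beta_0$ the fraction of the total mass of $e^{-\beta U_N}$ (with respect to surface measure) on the hyperplane $\{\boldsymbol u:(\boldsymbol u-\boldsymbol u^s)\cdot\boldsymbol\phi^{(1)}=0\}$ that lies in $\{|\boldsymbol u-\boldsymbol u^s|>\varepsilon\}$ is at most $Ke^{-c\beta}$, and likewise the fraction of the total mass of $e^{-\beta U_N}\,d\boldsymbol u$ on $\{\boldsymbol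 u:\pm(\boldsymbol u-\boldsymbol u^s)\cdot\boldsymbol\phi^{(1)}>0\}$ that lies in $\{|\boldsymbol u-\boldsymbol u^\pm|>\varepsilon\}$ is at most $Ke^{-c\beta}$. $f\sim g$ as $\beta\to\infty$ means $f/g\to1$. *)

theory Defs
  imports "HOL-Probability.Probability"
begin

subsection \<open>Flat surface measure\<close>

definition orthonormal_basis_of :: "'a::euclidean_space set \<Rightarrow> 'a set \<Rightarrow> bool" where
  "orthonormal_basis_of W B \<longleftrightarrow> pairwise orthogonal B \<and> (\<forall>b\<in>B. norm b = 1) \<and> span B = W"

definition directions :: "'a::real_vector set \<Rightarrow> 'a set" where
  "directions S = {x - y | x y. x \<in> S \<and> y \<in> S}"

definition chart_measure :: "'a::euclidean_space \<Rightarrow> 'a set \<Rightarrow> 'a measure" where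
  "chart_measure a B =
     distr (\<Pi>\<^sub>M b\<in>B. (lborel :: real measure)) borel (\<lambda>x. a + (\<Sum>b\<in>B. x b *\<^sub>R b))"

text \<open>The surface measure of a nonempty affine subspace \<open>S\<close>: Lebesgue measure in Cartesian
  coordinates on \<open>S\<close>, as a Borel measure on the ambient space that is carried by \<open>S\<close>. The
  parametrization is isometric, so its area density is 1. The result does not depend on the
  chosen origin and basis: see \<open>flat_surface_measure_eq\<close> below.\<close>

definition flat_surface_measure :: "'a::euclidean_space set \<Rightarrow> 'a measure" where
  "flat_surface_measure S =
     chart_measure (SOME a. a \<in> S) (SOME B. orthonormal_basis_of (directions S) B)"

lemma orthonormal_basis_of_finite:
  assumes "orthonormal_basis_of W B"
  shows "finite B" "card B = dim W"
proof -
  have "0 \<notin> B" "pairwise orthogonal B" "span B = W"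
    using assms by (auto simp: orthonormal_basis_of_def)
  then have "independent B" by (simp add: pairwise_orthogonal_independent)
  then show "finite B" "card B = dim W"
    using \<open>span B = W\<close> dim_span_eq_card_independent[of B] by (auto simp: independent_imp_finite)
qed

interpretation lborel_prod: product_sigma_finite "\<lambda>_::'a. lborel :: real measure"
  by standard

lemma PiM_lborel_translate:
  fixes B :: "'a set" and c :: "'a \<Rightarrow> real"
  assumes "finite B"
  shows "distr (\<Pi>\<^sub>M b\<in>B. lborel) (\<Pi>\<^sub>M b\<in>B. lborel) (\<lambda>x. \<lambda>b\<in>B. x b + c b) = (\<Pi>\<^sub>M b\<in>B. (lborel::real measure))"
    (is "distr ?M ?M ?t = ?M")
proof (rule lborel_prod.PiM_eqI[OF assms])
  fix A :: "'a \<Rightarrow> real set" assume A: "\<And>i. i \<in> B \<Longrightarrow> A i \<in> sets lborel"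
  have [measurable]: "?t \<in> measurable ?M ?M" by measurable
  have "Pi\<^sub>E B A \<in> sets ?M" by (rule sets_PiM_I_finite[OF assms]) (use A in auto)
  then have "emeasure (distr ?M ?M ?t) (Pi\<^sub>E B A) = emeasure ?M (?t -` Pi\<^sub>E B A \<inter> space ?M)"
    by (subst emeasure_distr) auto
  also have "?t -` Pi\<^sub>E B A \<inter> space ?M = Pi\<^sub>E B (\<lambda>b. (\<lambda>s. s + c b) -` A b)"
    by (auto simp: space_PiM PiE_iff extensional_def)
  also have "emeasure ?M \<dots> = (\<Prod>b\<in>B. emeasure lborel ((\<lambda>s. s + c b) -` A b))"
  proof (rule lborel_prod.emeasure_PiM[OF assms])
    fix b assume "b \<in> B"
    have "(\<lambda>s::real. s + c b) -` A b \<inter> space borel \<in> sets borel"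
      by (rule measurable_sets[of _ borel borel]) (use A \<open>b \<in> B\<close> in auto)
    then show "(\<lambda>s. s + c b) -` A b \<in> sets lborel" by simp
  qed
  also have "\<dots> = (\<Prod>b\<in>B. emeasure lborel (A b))"
  proof (rule prod.cong[OF refl])
    fix b assume "b \<in> B"
    have "emeasure lborel (A b) = emeasure (distr lborel borel ((+) (c b))) (A b)"
      by (simp add: lborel_distr_plus)
    also have "\<dots> = emeasure lborel (((+) (c b)) -` A b)"
      using A[OF \<open>b \<in> B\<close>] by (subst emeasure_distr) auto
    finally show "emeasure lborel ((\<lambda>s. s + c b) -` A b) = emeasure lborel (A b)"
      by (simp add: add.commute vimage_def)
  qed
  finally show "emeasure (distr ?M ?M ?t) (Pi\<^sub>E B A) = (\<Prod>i\<in>B. emeasure lborel (A i))" .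
qed simp

lemma chart_measurable [measurable]:
  fixes a :: "'a::euclidean_space"
  assumes "finite B"
  shows "(\<lambda>x. a + (\<Sum>b\<in>B. x b *\<^sub>R b)) \<in> borel_measurable (\<Pi>\<^sub>M b\<in>B. (lborel::real measure))"
  by measurable

lemma nn_integral_chart_measure:
  fixes a :: "'a::euclidean_space"
  assumes "finite B" "f \<in> borel_measurable borel"
  shows "(\<integral>\<^sup>+x. f x \<partial>chart_measure a B)
    = (\<integral>\<^sup>+x. f (a + (\<Sum>b\<in>B. x b *\<^sub>R b)) \<partial>(\<Pi>\<^sub>M b\<in>B. lborel))"
  unfolding chart_measure_def
  by (rule nn_integral_distr[OF chart_measurable[OF assms(1)]]) (use assms(2) in simp)

lemma nn_integral_chart_shift:
  fixes B :: "'a::euclidean_space set" and f :: "'a \<Rightarrow> ennreal"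
  assumes B: "orthonormal_basis_of W B" and w: "w \<in> W" and [measurable]: "f \<in> borel_measurable borel"
  shows "(\<integral>\<^sup>+x. f ((\<Sum>b\<in>B. x b *\<^sub>R b) + w) \<partial>(\<Pi>\<^sub>M b\<in>B. lborel))
    = (\<integral>\<^sup>+x. f (\<Sum>b\<in>B. x b *\<^sub>R b) \<partial>(\<Pi>\<^sub>M b\<in>B. lborel))"
proof -
  have fin: "finite B" using orthonormal_basis_of_finite(1)[OF B] .
  have "w \<in> span B" using B w by (simp add: orthonormal_basis_of_def)
  then obtain c where c: "w = (\<Sum>b\<in>B. c b *\<^sub>R b)" using span_finite[OF fin] by auto
  let ?M = "\<Pi>\<^sub>M b\<in>B. (lborel::real measure)"
  let ?t = "\<lambda>x. \<lambda>b\<in>B. x b + c b"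
  have [measurable]: "?t \<in> measurable ?M ?M" by measurable
  have [measurable]: "(\<lambda>x. f (\<Sum>b\<in>B. x b *\<^sub>R b)) \<in> borel_measurable ?M"
    using measurable_compose[OF chart_measurable[OF fin, of 0] assms(3)] by simp
  have "(\<integral>\<^sup>+x. f (\<Sum>b\<in>B. x b *\<^sub>R b) \<partial>?M) = (\<integral>\<^sup>+x. f (\<Sum>b\<in>B. x b *\<^sub>R b) \<partial>distr ?M ?M ?t)"
    by (simp add: PiM_lborel_translate[OF fin])
  also have "\<dots> = (\<integral>\<^sup>+x. f (\<Sum>b\<in>B. ?t x b *\<^sub>R b) \<partial>?M)"
    by (rule nn_integral_distr) measurable
  also have "\<dots> = (\<integral>\<^sup>+x. f ((\<Sum>b\<in>B. x b *\<^sub>R b) + w) \<partial>?M)"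
    by (simp add: c scaleR_add_left sum.distrib)
  finally show ?thesis by simp
qed

lemma norm_chart_sq:
  assumes "orthonormal_basis_of W B"
  shows "(norm (\<Sum>b\<in>B. x b *\<^sub>R b))\<^sup>2 = (\<Sum>b\<in>B. (x b)\<^sup>2)"
proof -
  have fin: "finite B" using orthonormal_basis_of_finite(1)[OF assms] .
  have *: "b \<bullet> b' = (if b = b' then 1 else 0)" if "b \<in> B" "b' \<in> B" for b b'
    using assms that by (auto simp: orthonormal_basis_of_def pairwise_def orthogonal_def norm_eq_1)
  have "(norm (\<Sum>b\<in>B. x b *\<^sub>R b))\<^sup>2 = (\<Sum>b\<in>B. \<Sum>b'\<in>B. x b * (x b' * (b \<bullet> b')))"
    by (simp add: power2_norm_eq_inner inner_sum_left inner_sum_right sum_distrib_left)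
       (metis (no_types, lifting) inner_commute sum.cong)
  also have "\<dots> = (\<Sum>b\<in>B. \<Sum>b'\<in>B. if b = b' then x b * x b' else 0)"
    by (intro sum.cong refl) (simp add: *)
  also have "\<dots> = (\<Sum>b\<in>B. (x b)\<^sup>2)"
    by (simp add: fin power2_eq_square)
  finally show ?thesis .
qed

lemma nn_integral_chart_gauss:
  assumes B: "orthonormal_basis_of W B"
  shows "(\<integral>\<^sup>+x. ennreal (exp (- (norm (\<Sum>b\<in>B. x b *\<^sub>R b))\<^sup>2)) \<partial>(\<Pi>\<^sub>M b\<in>B. lborel)) = (\<integral>\<^sup>+t. ennreal (exp (- t\<^sup>2)) \<partial>lborel) ^ card B"
proof -
  have fin: "finite B" using orthonormal_basis_of_finite(1)[OF B] .
  have "(\<integral>\<^sup>+x. ennreal (exp (- (norm (\<Sum>b\<in>B. x b *\<^sub>R b))\<^sup>2)) \<partial>(\<Pi>\<^sub>M b\<in>B. lborel))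
    = (\<integral>\<^sup>+x. (\<Prod>b\<in>B. ennreal (exp (- (x b)\<^sup>2))) \<partial>(\<Pi>\<^sub>M b\<in>B. lborel))"
    by (simp add: norm_chart_sq[OF B] sum_negf[symmetric] exp_sum[OF fin] prod_ennreal)
  also have "\<dots> = (\<Prod>b\<in>B. \<integral>\<^sup>+t. ennreal (exp (- t\<^sup>2)) \<partial>lborel)"
    by (rule lborel_prod.product_nn_integral_prod[OF fin]) measurable
  finally show ?thesis by simp
qed

lemma nn_integral_gauss: "(\<integral>\<^sup>+t. ennreal (exp (- t\<^sup>2)) \<partial>(lborel :: real measure)) = ennreal (sqrt pi)"
proof -
  have "has_bochner_integral lborel (\<lambda>t::real. exp (- t\<^sup>2)) (sqrt pi)"
    using has_bochner_integral_even_function[OF gaussian_moment_0] by simp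
  then show ?thesis
    by (simp add: has_bochner_integral_iff nn_integral_eq_integral)
qed

lemma nn_integral_chart_flip:
  fixes B C :: "'a::euclidean_space set" and f :: "'a \<Rightarrow> ennreal"
  assumes B: "orthonormal_basis_of W B" and C: "orthonormal_basis_of W C"
    and [measurable]: "f \<in> borel_measurable borel"
  shows "(\<integral>\<^sup>+x. f (\<Sum>b\<in>B. x b *\<^sub>R b) \<partial>(\<Pi>\<^sub>M b\<in>B. lborel))
    = (\<integral>\<^sup>+y. f (- (\<Sum>b\<in>C. y b *\<^sub>R b)) \<partial>(\<Pi>\<^sub>M b\<in>C. lborel))"
proof -
  have fin: "finite B" "finite C"
    using orthonormal_basis_of_finite(1) B C by auto
  let ?M = "\<Pi>\<^sub>M b\<in>B. (lborel::real measure)" and ?N = "\<Pi>\<^sub>M b\<in>C. (lborel::real measure)"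
  define p where "p x = (\<Sum>b\<in>B. x b *\<^sub>R b)" for x
  define q where "q y = (\<Sum>b\<in>C. y b *\<^sub>R b)" for y
  define h where "h v = ennreal (exp (- (norm v)\<^sup>2))" for v :: 'a
  interpret M: sigma_finite_measure ?M using lborel_prod.sigma_finite[OF fin(1)] .
  interpret N: sigma_finite_measure ?N using lborel_prod.sigma_finite[OF fin(2)] .
  interpret P: pair_sigma_finite ?M ?N ..
  have [measurable]: "p \<in> borel_measurable ?M"
    using chart_measurable[OF fin(1), of 0] by (simp add: p_def[abs_def])
  have [measurable]: "q \<in> borel_measurable ?N"
    using chart_measurable[OF fin(2), of 0] by (simp add: q_def[abs_def])
  have [measurable]: "h \<in> borel_measurable borel" unfolding h_def[abs_def] by measurable
  have pW: "p x \<in> W" for x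
  proof -
    have "p x \<in> span B" unfolding p_def by (intro span_sum span_scale span_base)
    then show ?thesis using B by (simp add: orthonormal_basis_of_def)
  qed
  have qW: "q y \<in> W" for y
  proof -
    have "q y \<in> span C" unfolding q_def by (intro span_sum span_scale span_base)
    then show ?thesis using C by (simp add: orthonormal_basis_of_def)
  qed
  have sub: "subspace W" using B by (auto simp: orthonormal_basis_of_def)
  have shp: "(\<integral>\<^sup>+x. g (p x + w) \<partial>?M) = (\<integral>\<^sup>+x. g (p x) \<partial>?M)"
    if "w \<in> W" "g \<in> borel_measurable borel" for g :: "'a \<Rightarrow> ennreal" and w
    unfolding p_def by (rule nn_integral_chart_shift[OF B that])
  have shq: "(\<integral>\<^sup>+x. g (q x + w) \<partial>?N) = (\<integral>\<^sup>+x. g (q x) \<partial>?N)"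
    if "w \<in> W" "g \<in> borel_measurable borel" for g :: "'a \<Rightarrow> ennreal" and w
    unfolding q_def by (rule nn_integral_chart_shift[OF C that])
  have "(\<integral>\<^sup>+x. f (p x) \<partial>?M) * (\<integral>\<^sup>+y. h (q y) \<partial>?N) = (\<integral>\<^sup>+x. f (p x) * (\<integral>\<^sup>+y. h (q y) \<partial>?N) \<partial>?M)"
    by (simp add: nn_integral_multc)
  also have "\<dots> = (\<integral>\<^sup>+x. f (p x) * (\<integral>\<^sup>+y. h (q y + p x) \<partial>?N) \<partial>?M)"
    by (simp add: shq pW)
  also have "\<dots> = (\<integral>\<^sup>+x. \<integral>\<^sup>+y. f (p x) * h (q y + p x) \<partial>?N \<partial>?M)"
    by (simp add: nn_integral_cmult)
  also have "\<dots> = (\<integral>\<^sup>+y. \<integral>\<^sup>+x. f (p x) * h (q y + p x) \<partial>?M \<partial>?N)"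
    by (rule P.Fubini'[symmetric]) measurable
  also have "\<dots> = (\<integral>\<^sup>+y. \<integral>\<^sup>+x. f (p x - q y) * h (p x) \<partial>?M \<partial>?N)"
  proof (rule nn_integral_cong)
    fix y
    show "(\<integral>\<^sup>+x. f (p x) * h (q y + p x) \<partial>?M) = (\<integral>\<^sup>+x. f (p x - q y) * h (p x) \<partial>?M)"
      using shp[OF qW[of y], of "\<lambda>z. f (z - q y) * h z"] by (simp add: add.commute)
  qed
  also have "\<dots> = (\<integral>\<^sup>+x. \<integral>\<^sup>+y. f (p x - q y) * h (p x) \<partial>?N \<partial>?M)"
    by (rule P.Fubini') measurable
  also have "\<dots> = (\<integral>\<^sup>+x. (\<integral>\<^sup>+y. f (p x - q y) \<partial>?N) * h (p x) \<partial>?M)"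
    by (simp add: nn_integral_multc)
  also have "\<dots> = (\<integral>\<^sup>+x. (\<integral>\<^sup>+y. f (- q y) \<partial>?N) * h (p x) \<partial>?M)"
  proof (rule nn_integral_cong)
    fix x
    have "- p x \<in> W" using pW[of x] sub by (simp add: subspace_neg)
    from shq[OF this, of "\<lambda>z. f (- z)"]
    show "(\<integral>\<^sup>+y. f (p x - q y) \<partial>?N) * h (p x) = (\<integral>\<^sup>+y. f (- q y) \<partial>?N) * h (p x)"
      by simp
  qed
  also have "\<dots> = (\<integral>\<^sup>+y. f (- q y) \<partial>?N) * (\<integral>\<^sup>+x. h (p x) \<partial>?M)"
    by (simp add: nn_integral_cmult)
  finally have eq: "(\<integral>\<^sup>+x. f (p x) \<partial>?M) * (\<integral>\<^sup>+y. h (q y) \<partial>?N) = (\<integral>\<^sup>+y. f (- q y) \<partial>?N) * (\<integral>\<^sup>+x. h (p x) \<partial>?M)" .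
  have 1: "(\<integral>\<^sup>+x. h (p x) \<partial>?M) = ennreal (sqrt pi) ^ dim W"
    using nn_integral_chart_gauss[OF B] orthonormal_basis_of_finite(2)[OF B]
    by (simp add: h_def p_def nn_integral_gauss)
  have 2: "(\<integral>\<^sup>+y. h (q y) \<partial>?N) = ennreal (sqrt pi) ^ dim W"
    using nn_integral_chart_gauss[OF C] orthonormal_basis_of_finite(2)[OF C]
    by (simp add: h_def q_def nn_integral_gauss)
  have pos: "ennreal (sqrt pi) ^ dim W = ennreal (sqrt pi ^ dim W)" "0 < sqrt pi ^ dim W"
    by (simp_all add: ennreal_power)
  define J where "J = ennreal (sqrt pi ^ dim W)"
  have J: "J \<noteq> 0" "J \<noteq> top" using pos(2) by (simp_all add: J_def)
  have "J * (\<integral>\<^sup>+x. f (p x) \<partial>?M) = J * (\<integral>\<^sup>+y. f (- q y) \<partial>?N)"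
    using eq unfolding 1 2 pos(1) J_def by (simp add: mult.commute)
  then show ?thesis
    using J unfolding ennreal_mult_cancel_left p_def q_def by simp
qed

lemma chart_measure_unique:
  fixes a a' :: "'a::euclidean_space"
  assumes B: "orthonormal_basis_of W B" and C: "orthonormal_basis_of W C" and a: "a - a' \<in> W"
  shows "chart_measure a B = chart_measure a' C"
proof (rule measure_eqI)
  have fin: "finite B" "finite C"
    using orthonormal_basis_of_finite(1) B C by auto
  show "sets (chart_measure a B) = sets (chart_measure a' C)" by (simp add: chart_measure_def)
  fix A assume "A \<in> sets (chart_measure a B)"
  then have [measurable]: "A \<in> sets borel" by (simp add: chart_measure_def)
  have "emeasure (chart_measure a B) A = (\<integral>\<^sup>+x. indicator A x \<partial>chart_measure a B)"
    by (simp add: nn_integral_indicator chart_measure_def)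
  also have "\<dots> = (\<integral>\<^sup>+x. indicator A (a' + ((\<Sum>b\<in>B. x b *\<^sub>R b) + (a - a'))) \<partial>(\<Pi>\<^sub>M b\<in>B. lborel))"
    by (subst nn_integral_chart_measure[OF fin(1)]) (simp_all add: algebra_simps)
  also have "\<dots> = (\<integral>\<^sup>+x. indicator A (a' + (\<Sum>b\<in>B. x b *\<^sub>R b)) \<partial>(\<Pi>\<^sub>M b\<in>B. lborel))"
    by (rule nn_integral_chart_shift[OF B a, of "\<lambda>z. indicator A (a' + z)"]) measurable
  also have "\<dots> = (\<integral>\<^sup>+x. indicator A (a' + - (\<Sum>b\<in>C. x b *\<^sub>R b)) \<partial>(\<Pi>\<^sub>M b\<in>C. lborel))"
    by (rule nn_integral_chart_flip[OF B C, of "\<lambda>z. indicator A (a' + z)"]) measurable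
  also have "\<dots> = (\<integral>\<^sup>+x. indicator A (a' + (\<Sum>b\<in>C. x b *\<^sub>R b)) \<partial>(\<Pi>\<^sub>M b\<in>C. lborel))"
    by (rule nn_integral_chart_flip[OF C C, of "\<lambda>z. indicator A (a' + z)", symmetric]) measurable
  also have "\<dots> = (\<integral>\<^sup>+x. indicator A x \<partial>chart_measure a' C)"
    by (subst nn_integral_chart_measure[OF fin(2)]) simp_all
  also have "\<dots> = emeasure (chart_measure a' C) A"
    by (simp add: nn_integral_indicator chart_measure_def)
  finally show "emeasure (chart_measure a B) A = emeasure (chart_measure a' C) A" .
qed

theorem flat_surface_measure_eq:
  fixes S :: "'a::euclidean_space set"
  assumes "a \<in> S" "orthonormal_basis_of (directions S) B"
  shows "flat_surface_measure S = chart_measure a B"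
proof -
  have "(SOME a. a \<in> S) \<in> S" using assms(1) by (rule someI)
  then have "(SOME a. a \<in> S) - a \<in> directions S" using assms(1) by (auto simp: directions_def)
  moreover have "orthonormal_basis_of (directions S) (SOME B. orthonormal_basis_of (directions S) B)"
    using assms(2) by (rule someI)
  ultimately show ?thesis
    unfolding flat_surface_measure_def using assms(2) by (intro chart_measure_unique)
qed

lemma orthonormal_basis_of_directions_exists:
  fixes S :: "'a::euclidean_space set"
  assumes "affine S" "S \<noteq> {}"
  shows "\<exists>B. orthonormal_basis_of (directions S) B"
proof -
  obtain a where a: "a \<in> S" using assms(2) by auto
  have "directions S = (\<lambda>x. x - a) ` S"
  proof (intro equalityI subsetI)
    fix z assume "z \<in> directions S"
    then obtain x y where z: "z = x - y" "x \<in> S" "y \<in> S" by (auto simp: directions_def)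
    have "a + 1 *\<^sub>R (x - y) \<in> S" by (rule mem_affine_3_minus[OF assms(1) a z(2,3)])
    then show "z \<in> (\<lambda>x. x - a) ` S" unfolding z(1) image_iff by (rule_tac x="a + 1 *\<^sub>R (x - y)" in bexI) simp_all
  qed (use a in \<open>auto simp: directions_def\<close>)
  then have "subspace (directions S)"
    using affine_diffs_subspace_subtract[OF assms(1) a] by simp
  from orthonormal_basis_subspace[OF this] show ?thesis
    unfolding orthonormal_basis_of_def by metis
qed


subsection \<open>Critical points and double wells\<close>

definition local_minimizer :: "('a::topological_space \<Rightarrow> real) \<Rightarrow> 'a \<Rightarrow> bool" where
  "local_minimizer f x \<longleftrightarrow> (\<forall>\<^sub>F y in nhds x. f x \<le> f y)"

definition critical_point :: "('a::real_normed_vector \<Rightarrow> real) \<Rightarrow> 'a \<Rightarrow> bool" where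
  "critical_point f x \<longleftrightarrow> (f has_derivative (\<lambda>_. 0)) (at x)"

definition hessian :: "(real^'n \<Rightarrow> real) \<Rightarrow> real^'n \<Rightarrow> real^'n^'n" where
  "hessian f x = (\<chi> i j. frechet_derivative
     (\<lambda>y. frechet_derivative f (at y) (axis j 1)) (at x) (axis i 1))"

definition morse_index :: "(real^'n \<Rightarrow> real) \<Rightarrow> real^'n \<Rightarrow> nat" where
  "morse_index f x =
     Max {dim W | W. subspace W \<and> (\<forall>w\<in>W. w \<noteq> 0 \<longrightarrow> w \<bullet> (hessian f x *v w) < 0)}"

text \<open>Minimizers are not required to be strict, so a potential that is constant on an interval
  never qualifies, and the two wells are separated by exactly one local maximum. The depths of
  the wells may differ.\<close>

definition double_well :: "(real \<Rightarrow> real) \<Rightarrow> bool" where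
  "double_well V \<longleftrightarrow>
     (\<forall>k x. (deriv ^^ k) V differentiable (at x)) \<and>
     card {x. local_minimizer V x} = 2 \<and>
     (\<exists>m. \<forall>x. m \<le> V x) \<and>
     (\<exists>C>0. \<forall>\<^sub>F x in at_infinity. C * x\<^sup>2 \<le> V x)"


subsection \<open>The chain\<close>

datatype boundary = Dirichlet | Neumann

text \<open>\<open>\<real>\<^sup>N\<close> is \<open>real^'n\<close> with \<open>N = CARD('n)\<close>; the bijection \<open>e\<close> from \<open>{1..N}\<close> to \<open>'n\<close>
  numbers the coordinates. The function \<open>site bc e u\<close> is the sequence \<open>u\<^sub>0, u\<^sub>1, \<dots>, u\<^sub>N, u\<^sub>N\<^sub>+\<^sub>1\<close>,
  the two ends being given by the boundary condition.\<close>

definition site :: "boundary \<Rightarrow> (nat \<Rightarrow> 'n) \<Rightarrow> real^'n \<Rightarrow> nat \<Rightarrow> real" where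
  "site bc e u j =
     (if 1 \<le> j \<and> j \<le> CARD('n) then u $ e j
      else case bc of
        Dirichlet \<Rightarrow> 0
      | Neumann \<Rightarrow> if j = 0 then u $ e 1 else u $ e CARD('n))"

definition U_N :: "(real \<Rightarrow> real) \<Rightarrow> real \<Rightarrow> boundary \<Rightarrow> (nat \<Rightarrow> 'n::finite) \<Rightarrow> real^'n \<Rightarrow> real" where
  "U_N V \<delta> bc e u =
     1 / real CARD('n) * (\<Sum>j=1..CARD('n). V (site bc e u j)) +
     real CARD('n) * (\<Sum>j=0..CARD('n). 1/2 * \<delta>\<^sup>2 * (site bc e u (j + 1) - site bc e u j)\<^sup>2)"

definition H_N :: "(real \<Rightarrow> real) \<Rightarrow> real \<Rightarrow> boundary \<Rightarrow> (nat \<Rightarrow> 'n::finite) \<Rightarrow>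
    (real^'n) \<times> (real^'n) \<Rightarrow> real" where
  "H_N V \<delta> bc e z =
     1 / (2 * real CARD('n)) * (\<Sum>j=1..CARD('n). (fst z $ e j)\<^sup>2) + U_N V \<delta> bc e (snd z)"

text \<open>Eigenpairs of the linearization at \<open>u\<close>, which is \<open>N\<close> times the Hessian of \<open>U_N\<close>.\<close>

definition eigenpair :: "(real \<Rightarrow> real) \<Rightarrow> real \<Rightarrow> boundary \<Rightarrow> (nat \<Rightarrow> 'n::finite) \<Rightarrow> real^'n \<Rightarrow>
    real \<Rightarrow> real^'n \<Rightarrow> bool" where
  "eigenpair V \<delta> bc e u l \<phi> \<longleftrightarrow> \<phi> \<noteq> 0 \<and>
     (\<forall>j\<in>{1..CARD('n)}.
        l * site bc e \<phi> j =
          - \<delta>\<^sup>2 * (real CARD('n))\<^sup>2 * (site bc e \<phi> (j - 1) - 2 * site bc e \<phi> j + site bc e \<phi> (j + 1))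
          + deriv (deriv V) (site bc e u j) * site bc e \<phi> j)"

definition hyperplane :: "real^'n \<Rightarrow> real^'n \<Rightarrow> (real^'n) set" where
  "hyperplane us \<phi> = {u. (u - us) \<bullet> \<phi> = 0}"

definition half_space :: "real \<Rightarrow> real^'n \<Rightarrow> real^'n \<Rightarrow> (real^'n) set" where
  "half_space s us \<phi> = {u. s * ((u - us) \<bullet> \<phi>) > 0}"

definition dividing_surface :: "real^'n \<Rightarrow> real^'n \<Rightarrow> ((real^'n) \<times> (real^'n)) set" where
  "dividing_surface us \<phi> = {(p, u). (u - us) \<bullet> \<phi> = 0}"

text \<open>\<open>B\<^sub>+\<close> and \<open>B\<^sub>-\<close> are the cases \<open>s = 1\<close> and \<open>s = -1\<close>.\<close>

definition region :: "real \<Rightarrow> real^'n \<Rightarrow> real^'n \<Rightarrow> ((real^'n) \<times> (real^'n)) set" where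
  "region s us \<phi> = {(p, u). s * ((u - us) \<bullet> \<phi>) > 0}"

definition concentrated_near ::
    "'a::real_normed_vector measure \<Rightarrow> 'a set \<Rightarrow> ('a \<Rightarrow> real) \<Rightarrow> 'a \<Rightarrow> bool" where
  "concentrated_near M A U x \<longleftrightarrow>
     (\<forall>\<epsilon>>0. \<exists>K>0. \<exists>c>0. \<exists>\<beta>\<^sub>0>0. \<forall>\<beta>>\<beta>\<^sub>0.
        (LINT u : A \<inter> {u. norm (u - x) > \<epsilon>} | M. exp (- \<beta> * U u)) /
        (LINT u : A | M. exp (- \<beta> * U u)) \<le> K * exp (- c * \<beta>))"

text \<open>Surface area of the \<open>n\<close>-dimensional unit sphere in \<open>\<real>\<^sup>n\<^sup>+\<^sup>1\<close>.\<close>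

definition sphere_area :: "nat \<Rightarrow> real" where
  "sphere_area n = 2 * pi powr ((real n + 1) / 2) / Gamma ((real n + 1) / 2)"

end

theory Submission
  imports Defs "HOL-Real_Asymp.Real_Asymp"
begin

text \<open>The kinetic energy makes every integral split into an exact Gaussian integral in the momenta
  times an integral of \<open>exp (- \<beta> U)\<close> over a half space, respectively over the hyperplane. By the
  concentration assumption only a small ball around the critical point matters in the latter, and
  there rescaling by \<open>1 / sqrt \<beta>\<close> and dominated convergence replace \<open>U\<close> by its second-order
  expansion. Since the spectrum of the linearization is simple, its eigenvectors form an orthogonal
  basis, in which the resulting Gaussian integral factorizes; the eigenvectors \<open>\<phi> 2, \<dots>, \<phi> N\<close> span
  the direction space of the hyperplane. Since the eigenvalues are those of \<open>N\<close> times the Hessian,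
  each eigenvalue \<open>l\<close> contributes a factor \<open>sqrt (2 \<pi> N / (\<beta> l))\<close>.\<close>

subsection \<open>Chart measures\<close>

text \<open>\<open>flat_surface_measure\<close> rests on an arbitrary origin and orthonormal basis.
  Since the result does not depend on them, the origin can be put at the critical point and the
  basis built from normalized eigenvectors. Lebesgue measure on the whole space is the case of a
  full basis, so a single Laplace theorem about charts serves the half spaces and the hyperplane
  alike. This matters at the saddle: the quadratic form is indefinite there, but it is positive on
  the directions of the hyperplane, the only ones the chart sees. The unstable direction
  \<open>\<phi> 1\<close> enters only as the normal of the flux.

  Origin of the constants: the momenta give \<open>sqrt (2 pi N / \<beta>) ^ N\<close>, the
  positions the same power over the roots of the eigenvalues, together
  \<open>(2 pi N / \<beta>) ^ N\<close>. In the flux the normal momentum gives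
  \<open>N / \<beta>\<close>, while the other N - 1 momenta and the N - 1 positions give
  \<open>(2 pi N / \<beta>) ^ (N - 1)\<close>. Spheres and factorials merely encode powers of pi: (N
  - 1)! times the area of the (2N - 1)-sphere is \<open>2 pi ^ N\<close>, and (N - 2)! times that of
  the (2N - 3)-sphere is \<open>2 pi ^ (N - 1)\<close>.\<close>

lemma PiM_lborel_reindex:
  assumes "finite B" "inj_on k B"
  shows "distr (\<Pi>\<^sub>M c\<in>k ` B. lborel) (\<Pi>\<^sub>M b\<in>B. lborel) (\<lambda>x. \<lambda>b\<in>B. x (k b))
    = (\<Pi>\<^sub>M b\<in>B. (lborel :: real measure))"
    (is "distr ?K ?M ?t = ?M")
proof (rule lborel_prod.PiM_eqI[OF assms(1)])
  fix A :: "_ \<Rightarrow> real set" assume A: "\<And>i. i \<in> B \<Longrightarrow> A i \<in> sets lborel"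
  have [measurable]: "?t \<in> measurable ?K ?M"
    by (rule measurable_restrict) (rule measurable_component_singleton, simp)
  define A' where "A' c = A (the_inv_into B k c)" for c
  have A': "A' (k b) = A b" if "b \<in> B" for b
    using that assms(2) by (simp add: A'_def the_inv_into_f_f)
  have "Pi\<^sub>E B A \<in> sets ?M" by (rule sets_PiM_I_finite[OF assms(1)]) (use A in auto)
  then have "emeasure (distr ?K ?M ?t) (Pi\<^sub>E B A) = emeasure ?K (?t -` Pi\<^sub>E B A \<inter> space ?K)"
    by (subst emeasure_distr) auto
  also have "?t -` Pi\<^sub>E B A \<inter> space ?K = Pi\<^sub>E (k ` B) A'"
    by (auto simp: space_PiM PiE_iff extensional_def A')
  also have "emeasure ?K \<dots> = (\<Prod>c\<in>k ` B. emeasure lborel (A' c))"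
    by (rule lborel_prod.emeasure_PiM) (use assms A A' in auto)
  also have "\<dots> = (\<Prod>b\<in>B. emeasure lborel (A b))"
    using assms(2) by (subst prod.reindex) (auto simp: A' intro!: prod.cong)
  finally show "emeasure (distr ?K ?M ?t) (Pi\<^sub>E B A) = (\<Prod>i\<in>B. emeasure lborel (A i))" .
qed simp

text \<open>Each coordinate contributes one factor \<open>t\<close>. It suffices to compare boxes,
  which determine the product measure. Used with \<open>t = 1 / sqrt \<beta>\<close>.\<close>

lemma PiM_lborel_scale:
  fixes t :: real
  assumes "finite B" "0 < t"
  shows "scale_measure (ennreal (t ^ card B))
      (distr (\<Pi>\<^sub>M b\<in>B. lborel) (\<Pi>\<^sub>M b\<in>B. lborel) (\<lambda>x. \<lambda>b\<in>B. t * x b))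
    = (\<Pi>\<^sub>M b\<in>B. (lborel :: real measure))"
    (is "scale_measure _ (distr ?M ?M ?t) = ?M")
proof (rule lborel_prod.PiM_eqI[OF assms(1)])
  fix A :: "_ \<Rightarrow> real set" assume A: "\<And>i. i \<in> B \<Longrightarrow> A i \<in> sets lborel"
  have [measurable]: "?t \<in> measurable ?M ?M" by measurable
  have "Pi\<^sub>E B A \<in> sets ?M" by (rule sets_PiM_I_finite[OF assms(1)]) (use A in auto)
  then have "emeasure (distr ?M ?M ?t) (Pi\<^sub>E B A) = emeasure ?M (?t -` Pi\<^sub>E B A \<inter> space ?M)"
    by (subst emeasure_distr) auto
  also have "?t -` Pi\<^sub>E B A \<inter> space ?M = Pi\<^sub>E B (\<lambda>b. (*) t -` A b)"
    by (auto simp: space_PiM PiE_iff extensional_def)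
  also have "emeasure ?M \<dots> = (\<Prod>b\<in>B. emeasure lborel ((*) t -` A b))"
  proof (rule lborel_prod.emeasure_PiM[OF assms(1)])
    fix b assume "b \<in> B"
    have "(*) t -` A b \<inter> space borel \<in> sets borel"
      by (rule measurable_sets[of _ borel borel]) (use A \<open>b \<in> B\<close> in auto)
    then show "(*) t -` A b \<in> sets lborel" by simp
  qed
  finally have "emeasure (scale_measure (ennreal (t ^ card B)) (distr ?M ?M ?t)) (Pi\<^sub>E B A)
      = ennreal (t ^ card B) * (\<Prod>b\<in>B. emeasure lborel ((*) t -` A b))"
    by (simp only: emeasure_scale_measure)
  also have "\<dots> = (\<Prod>b\<in>B. ennreal t * emeasure lborel ((*) t -` A b))"
    using assms(2) by (simp add: prod.distrib ennreal_power)
  also have "\<dots> = (\<Prod>b\<in>B. emeasure lborel (A b))"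
  proof (rule prod.cong[OF refl])
    fix b assume b: "b \<in> B"
    have "emeasure lborel (A b) = emeasure (density (distr lborel borel ((*) t)) (\<lambda>_. ennreal \<bar>t\<bar>)) (A b)"
      using assms(2) by (subst lborel_distr_mult'[of t]) auto
    also have "\<dots> = ennreal t * emeasure lborel ((*) t -` A b)"
      using A[OF b] assms(2)
      by (subst emeasure_density) (auto simp: nn_integral_cmult_indicator emeasure_distr)
    finally show "ennreal t * emeasure lborel ((*) t -` A b) = emeasure lborel (A b)" ..
  qed
  finally show "emeasure (scale_measure (ennreal (t ^ card B)) (distr ?M ?M ?t)) (Pi\<^sub>E B A)
      = (\<Prod>i\<in>B. emeasure lborel (A i))" .
qed simp

lemma orthonormal_basis_of_Basis: "orthonormal_basis_of UNIV (Basis :: 'a::euclidean_space set)"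
  by (auto simp: orthonormal_basis_of_def pairwise_def orthogonal_def inner_not_same_Basis)

text \<open>\<open>lborel\<close> is itself the chart measure of the standard basis, and charts do
  not depend on the basis. This makes eigenvector coordinates, or coordinates containing the normal,
  available for ordinary Lebesgue integrals.\<close>

lemma chart_measure_UNIV:
  assumes "orthonormal_basis_of UNIV B"
  shows "chart_measure a B = lborel"
proof -
  have "chart_measure a B = chart_measure 0 Basis"
    by (rule chart_measure_unique[OF assms orthonormal_basis_of_Basis]) simp
  also have "\<dots> = lborel"
    by (simp add: chart_measure_def lborel_eq[symmetric])
  finally show ?thesis .
qed

lemma space_chart_measure [simp]: "space (chart_measure a B) = UNIV"
  by (simp add: chart_measure_def)

lemma sets_chart_measure [simp, measurable_cong]: "sets (chart_measure a B) = sets borel"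
  by (simp add: chart_measure_def)

section \<open>Charts on a product space\<close>

definition Times_basis :: "'a::euclidean_space set \<Rightarrow> 'b::euclidean_space set \<Rightarrow> ('a \<times> 'b) set" where
  "Times_basis B C = (\<lambda>b. (b, 0)) ` B \<union> (\<lambda>c. (0, c)) ` C"

lemma Times_basis_Basis: "Times_basis Basis Basis = Basis"
  by (simp add: Times_basis_def Basis_prod_def)

lemma span_Times_basis:
  "span (Times_basis B C :: ('a::euclidean_space \<times> 'b::euclidean_space) set) = span B \<times> span C"
proof (intro equalityI subsetI)
  have sub: "subspace (span B \<times> span C)"
    by (auto simp: subspace_def zero_prod_def span_zero span_add span_scale)
  fix z assume "z \<in> span (Times_basis B C)"
  moreover have "Times_basis B C \<subseteq> span B \<times> span C"
    by (auto simp: Times_basis_def span_base span_zero)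
  ultimately show "z \<in> span B \<times> span C"
    using span_minimal[OF _ sub] by blast
next
  fix z assume "z \<in> span B \<times> span C"
  then obtain x y where z: "z = (x, y)" "x \<in> span B" "y \<in> span C" by auto
  have l: "linear (\<lambda>b::'a. (b, 0::'b))" "linear (\<lambda>c::'b. (0::'a, c))"
    by (auto intro!: linearI)
  have "(x, 0) \<in> span ((\<lambda>b. (b, 0::'b)) ` B)" "(0, y) \<in> span ((\<lambda>c. (0::'a, c)) ` C)"
    using z linear_span_image[OF l(1), of B] linear_span_image[OF l(2), of C] by auto
  then have "(x, 0) \<in> span (Times_basis B C)" "(0, y) \<in> span (Times_basis B C)"
    using span_mono[of _ "Times_basis B C"] by (auto simp: Times_basis_def)
  from span_add[OF this] show "z \<in> span (Times_basis B C)" using z by simp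
qed

lemma orthonormal_basis_of_Times:
  assumes "orthonormal_basis_of W B" "orthonormal_basis_of X C"
  shows "orthonormal_basis_of (W \<times> X) (Times_basis B C)"
proof -
  have "pairwise orthogonal (Times_basis B C)"
    using assms by (auto simp: orthonormal_basis_of_def pairwise_def Times_basis_def orthogonal_def) blast+
  moreover have "\<forall>b\<in>Times_basis B C. norm b = 1"
    using assms by (auto simp: orthonormal_basis_of_def Times_basis_def norm_Pair)
  ultimately show ?thesis
    using assms by (simp add: orthonormal_basis_of_def span_Times_basis)
qed

text \<open>Tonelli for charts: coordinates indexed by the union of the two embedded bases split
  into two groups. The embedded bases could only share the zero vector, which
  \<open>0 \<notin> B\<close> excludes.\<close>

lemma nn_integral_chart_Times:
  fixes g :: "'a::euclidean_space \<Rightarrow> ennreal" and h :: "'b::euclidean_space \<Rightarrow> ennreal"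
  assumes fin: "finite B" "finite C" and "0 \<notin> B"
    and [measurable]: "g \<in> borel_measurable borel" "h \<in> borel_measurable borel"
  shows "(\<integral>\<^sup>+z. g (fst z) * h (snd z) \<partial>chart_measure (a, a') (Times_basis B C))
    = (\<integral>\<^sup>+p. g p \<partial>chart_measure a B) * (\<integral>\<^sup>+u. h u \<partial>chart_measure a' C)"
proof -
  define I where "I = (\<lambda>b::'a. (b, 0::'b)) ` B"
  define J where "J = (\<lambda>c::'b. (0::'a, c)) ` C"
  have IJ: "I \<inter> J = {}" "finite I" "finite J" using assms by (auto simp: I_def J_def)
  have inj: "inj_on (\<lambda>b::'a. (b, 0::'b)) B" "inj_on (\<lambda>c::'b. (0::'a, c)) C" by (auto simp: inj_on_def)
  let ?L = "\<lambda>K. \<Pi>\<^sub>M b\<in>K. (lborel :: real measure)"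
  let ?rI = "\<lambda>x. \<lambda>b\<in>B. x (b, 0::'b)" and ?rJ = "\<lambda>y. \<lambda>c\<in>C. y (0::'a, c)"
  define G where "G x = g (a + (\<Sum>b\<in>B. x b *\<^sub>R b))" for x
  define H where "H x = h (a' + (\<Sum>b\<in>C. x b *\<^sub>R b))" for x
  have [measurable]: "G \<in> borel_measurable (?L B)"
    unfolding G_def[abs_def] using fin by measurable
  have [measurable]: "H \<in> borel_measurable (?L C)"
    unfolding H_def[abs_def] using fin by measurable
  have [measurable]: "?rI \<in> measurable (?L I) (?L B)"
    by (rule measurable_restrict) (rule measurable_component_singleton, simp add: I_def)
  have [measurable]: "?rJ \<in> measurable (?L J) (?L C)"
    by (rule measurable_restrict) (rule measurable_component_singleton, simp add: J_def)
  have s: "(a, a') + (\<Sum>b\<in>I \<union> J. x b *\<^sub>R b)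
     = (a + (\<Sum>b\<in>B. x (b, 0) *\<^sub>R b), a' + (\<Sum>c\<in>C. x (0, c) *\<^sub>R c))" for x :: "'a \<times> 'b \<Rightarrow> real"
    using IJ inj
    by (simp add: sum.union_disjoint I_def J_def sum.reindex prod_eq_iff fst_sum snd_sum)
  have m: "(\<lambda>z. g (fst z) * h (snd z)) \<in> borel_measurable borel"
    unfolding borel_prod[symmetric] by measurable
  have m': "(\<lambda>x. g (fst ((a, a') + (\<Sum>b\<in>I \<union> J. x b *\<^sub>R b))) * h (snd ((a, a') + (\<Sum>b\<in>I \<union> J. x b *\<^sub>R b))))
      \<in> borel_measurable (?L (I \<union> J))"
    using IJ by (intro measurable_compose[OF chart_measurable m]) auto
  have "(\<integral>\<^sup>+z. g (fst z) * h (snd z) \<partial>chart_measure (a, a') (Times_basis B C))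
     = (\<integral>\<^sup>+x. g (fst ((a, a') + (\<Sum>b\<in>I \<union> J. x b *\<^sub>R b))) * h (snd ((a, a') + (\<Sum>b\<in>I \<union> J. x b *\<^sub>R b))) \<partial>?L (I \<union> J))"
    unfolding Times_basis_def I_def[symmetric] J_def[symmetric]
    using IJ by (subst nn_integral_chart_measure[OF _ m]) auto
  also have "\<dots> = (\<integral>\<^sup>+x. \<integral>\<^sup>+y. g (fst ((a, a') + (\<Sum>b\<in>I \<union> J. merge I J (x, y) b *\<^sub>R b)))
       * h (snd ((a, a') + (\<Sum>b\<in>I \<union> J. merge I J (x, y) b *\<^sub>R b))) \<partial>?L J \<partial>?L I)"
    by (rule lborel_prod.product_nn_integral_fold[OF IJ m'])
  also have "\<dots> = (\<integral>\<^sup>+x. \<integral>\<^sup>+y. G (?rI x) * H (?rJ y) \<partial>?L J \<partial>?L I)"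
  proof (intro nn_integral_cong arg_cong2[where f="(*)"])
    fix x y :: "'a \<times> 'b \<Rightarrow> real"
    have 1: "merge I J (x, y) (b, 0) = x (b, 0)" if "b \<in> B" for b
      using that by (auto simp: merge_def I_def)
    have 2: "merge I J (x, y) (0, c) = y (0, c)" if "c \<in> C" for c
      using that assms(3) by (auto simp: merge_def I_def J_def)
    show "g (fst ((a, a') + (\<Sum>b\<in>I \<union> J. merge I J (x, y) b *\<^sub>R b))) = G (?rI x)"
      unfolding s G_def by (auto intro!: arg_cong[where f=g] sum.cong simp: 1)
    show "h (snd ((a, a') + (\<Sum>b\<in>I \<union> J. merge I J (x, y) b *\<^sub>R b))) = H (?rJ y)"
      unfolding s H_def by (auto intro!: arg_cong[where f=h] sum.cong simp: 2)
  qed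
  also have "\<dots> = (\<integral>\<^sup>+x. G (?rI x) \<partial>?L I) * (\<integral>\<^sup>+y. H (?rJ y) \<partial>?L J)"
    by (simp add: nn_integral_cmult nn_integral_multc)
  \<comment> \<open>The remaining coordinates are indexed by pairs \<open>(b, 0)\<close>; renaming
    them to \<open>b\<close> preserves the product measure.\<close>
  also have "(\<integral>\<^sup>+x. G (?rI x) \<partial>?L I) = (\<integral>\<^sup>+x. G x \<partial>?L B)"
    using PiM_lborel_reindex[OF fin(1) inj(1)] nn_integral_distr[of ?rI "?L I" "?L B" G]
    by (simp add: I_def[symmetric])
  also have "(\<integral>\<^sup>+y. H (?rJ y) \<partial>?L J) = (\<integral>\<^sup>+y. H y \<partial>?L C)"
    using PiM_lborel_reindex[OF fin(2) inj(2)] nn_integral_distr[of ?rJ "?L J" "?L C" H]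
    by (simp add: J_def[symmetric])
  finally show ?thesis
    unfolding G_def H_def by (simp add: nn_integral_chart_measure fin)
qed

text \<open>For nonnegative integrands the Bochner integral is \<open>enn2real\<close> of the
  nonnegative one, and \<open>enn2real\<close> is multiplicative even at \<open>top\<close>. The
  factorization therefore holds without integrability.\<close>

lemma integral_chart_Times:
  fixes g :: "'a::euclidean_space \<Rightarrow> real" and h :: "'b::euclidean_space \<Rightarrow> real"
  assumes "finite B" "finite C" "0 \<notin> B"
    and [measurable]: "g \<in> borel_measurable borel" "h \<in> borel_measurable borel"
    and nonneg: "\<And>p. 0 \<le> g p" "\<And>u. 0 \<le> h u"
  shows "(LINT z|chart_measure (a, a') (Times_basis B C). g (fst z) * h (snd z))
    = (LINT p|chart_measure a B. g p) * (LINT u|chart_measure a' C. h u)"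
proof -
  have m: "(\<lambda>z. g (fst z) * h (snd z)) \<in> borel_measurable borel"
    unfolding borel_prod[symmetric] by measurable
  have "(LINT z|chart_measure (a, a') (Times_basis B C). g (fst z) * h (snd z))
     = enn2real (\<integral>\<^sup>+z. ennreal (g (fst z)) * ennreal (h (snd z)) \<partial>chart_measure (a, a') (Times_basis B C))"
    using nonneg m by (subst integral_eq_nn_integral) (auto simp: ennreal_mult)
  also have "\<dots> = enn2real (\<integral>\<^sup>+p. ennreal (g p) \<partial>chart_measure a B)
       * enn2real (\<integral>\<^sup>+u. ennreal (h u) \<partial>chart_measure a' C)"
    using assms by (subst nn_integral_chart_Times) (auto simp: enn2real_mult)
  also have "\<dots> = (LINT p|chart_measure a B. g p) * (LINT u|chart_measure a' C. h u)"
    using nonneg by (simp add: integral_eq_nn_integral)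
  finally show ?thesis .
qed

subsection \<open>Gaussian integrals and Laplace's method\<close>

lemma integral_gauss:
  assumes "0 < a"
  shows "integrable lborel (\<lambda>t::real. exp (- (t\<^sup>2 * a)))"
    and "(LINT t|lborel. exp (- (t\<^sup>2 * a))) = sqrt (pi / a)"
proof -
  define s where "s = sqrt (1 / (2 * a))"
  have s: "0 < s" "s\<^sup>2 = 1 / (2 * a)" using assms by (auto simp: s_def)
  have eq: "exp (- (t\<^sup>2 * a)) = sqrt (pi / a) * normal_density 0 s t" for t
    using assms by (simp add: normal_density_def s(2) real_sqrt_divide)
  show "integrable lborel (\<lambda>t::real. exp (- (t\<^sup>2 * a)))"
    unfolding eq using s by simp
  show "(LINT t|lborel. exp (- (t\<^sup>2 * a))) = sqrt (pi / a)"
    unfolding eq using s by simp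
qed

lemma integral_PiM_gauss:
  assumes "finite B" "\<And>b. b \<in> B \<Longrightarrow> 0 < a b"
  shows "integrable (\<Pi>\<^sub>M b\<in>B. lborel) (\<lambda>x. exp (- (\<Sum>b\<in>B. (x b)\<^sup>2 * a b)))"
    and "(LINT x|(\<Pi>\<^sub>M b\<in>B. lborel). exp (- (\<Sum>b\<in>B. (x b)\<^sup>2 * a b))) = (\<Prod>b\<in>B. sqrt (pi / a b))"
proof -
  have eq: "exp (- (\<Sum>b\<in>B. (x b)\<^sup>2 * a b)) = (\<Prod>b\<in>B. exp (- ((x b)\<^sup>2 * a b)))" for x :: "'a \<Rightarrow> real"
    by (simp add: sum_negf[symmetric] exp_sum assms(1))
  show "integrable (\<Pi>\<^sub>M b\<in>B. lborel) (\<lambda>x. exp (- (\<Sum>b\<in>B. (x b)\<^sup>2 * a b)))"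
    unfolding eq by (rule lborel_prod.product_integrable_prod[OF assms(1)])
      (use assms integral_gauss in auto)
  show "(LINT x|(\<Pi>\<^sub>M b\<in>B. lborel). exp (- (\<Sum>b\<in>B. (x b)\<^sup>2 * a b))) = (\<Prod>b\<in>B. sqrt (pi / a b))"
    unfolding eq by (subst lborel_prod.product_integral_prod[OF assms(1)])
      (use assms integral_gauss in auto)
qed

lemma integral_PiM_lborel_scale:
  fixes f :: "('a \<Rightarrow> real) \<Rightarrow> real"
  assumes fin: "finite B" and t: "0 < t"
    and [measurable]: "f \<in> borel_measurable (\<Pi>\<^sub>M b\<in>B. lborel)" and nonneg: "\<And>x. 0 \<le> f x"
  shows "(LINT x|(\<Pi>\<^sub>M b\<in>B. lborel). f x) = t ^ card B * (LINT x|(\<Pi>\<^sub>M b\<in>B. lborel). f (\<lambda>b\<in>B. t * x b))"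
proof -
  let ?M = "\<Pi>\<^sub>M b\<in>B. (lborel :: real measure)"
  let ?t = "\<lambda>x. \<lambda>b\<in>B. t * x b"
  have [measurable]: "?t \<in> measurable ?M ?M" by measurable
  have "(\<integral>\<^sup>+x. f x \<partial>?M) = (\<integral>\<^sup>+x. f x \<partial>scale_measure (ennreal (t ^ card B)) (distr ?M ?M ?t))"
    by (simp only: PiM_lborel_scale[OF fin t])
  also have "\<dots> = ennreal (t ^ card B) * (\<integral>\<^sup>+x. f (?t x) \<partial>?M)"
    by (subst nn_integral_scale_measure) (auto simp: nn_integral_distr)
  finally show ?thesis
    using t nonneg by (simp add: integral_eq_nn_integral enn2real_mult)
qed

text \<open>After the substitution \<open>w = y / sqrt \<beta>\<close> the exponent is
  \<open>\<beta>\<close> times the increment of \<open>U\<close>, which tends to \<open>q y\<close>.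
  For a small ball the increment is at least \<open>q / 2\<close>, which yields a Gaussian majorant
  independent of \<open>\<beta>\<close>. There is no linear term in \<open>expand\<close>: the
  centre is meant to be a critical point.\<close>

lemma laplace_local:
  fixes U q :: "'a::euclidean_space \<Rightarrow> real"
  assumes B: "orthonormal_basis_of W B" and [measurable]: "U \<in> borel_measurable borel"
    and q: "\<And>x. q (\<Sum>b\<in>B. x b *\<^sub>R b) = (\<Sum>b\<in>B. (x b)\<^sup>2 * q b)" and q_pos: "\<And>b. b \<in> B \<Longrightarrow> 0 < q b"
    and expand: "\<And>\<eta>. 0 < \<eta> \<Longrightarrow> \<forall>\<^sub>F w in nhds 0. \<bar>U (u\<^sub>0 + w) - U u\<^sub>0 - q w\<bar> \<le> \<eta> * (norm w)\<^sup>2"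
  shows "\<forall>\<^sub>F \<epsilon> in at_right 0. ((\<lambda>\<beta>. sqrt \<beta> ^ card B * exp (\<beta> * U u\<^sub>0) *
      (LINT u : cball u\<^sub>0 \<epsilon> | chart_measure u\<^sub>0 B. exp (- \<beta> * U u))) \<longlongrightarrow> (\<Prod>b\<in>B. sqrt (pi / q b))) at_top"
proof -
  note fin [simp] = orthonormal_basis_of_finite(1)[OF B]
  let ?M = "\<Pi>\<^sub>M b\<in>B. (lborel :: real measure)"
  define p where "p x = (\<Sum>b\<in>B. x b *\<^sub>R b)" for x
  have [measurable]: "p \<in> borel_measurable ?M"
    using chart_measurable[OF fin, of 0] by (simp add: p_def[abs_def])
  have np: "(norm (p x))\<^sup>2 = (\<Sum>b\<in>B. (x b)\<^sup>2)" for x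
    unfolding p_def by (rule norm_chart_sq[OF B])
  \<comment> \<open>A lower bound for the coefficients of \<open>q\<close>; the inserted 1 keeps the
    set nonempty when the chart has dimension 0.\<close>
  define c where "c = Min (insert 1 (q ` B))"
  have c: "0 < c" "\<And>b. b \<in> B \<Longrightarrow> c \<le> q b" using q_pos by (auto simp: c_def)
  have qc: "c * (norm (p x))\<^sup>2 \<le> q (p x)" for x
    unfolding np unfolding p_def q sum_distrib_left
    by (intro sum_mono) (use c in \<open>auto simp: mult.commute intro!: mult_right_mono\<close>)
  have pt: "p (\<lambda>b\<in>B. t * x b) = t *\<^sub>R p x" for t x
    by (simp add: p_def scaleR_sum_right)
  have qt: "q (t *\<^sub>R p x) = t\<^sup>2 * q (p x)" for t x
    unfolding pt[symmetric] unfolding p_def q by (simp add: power_mult_distrib sum_distrib_left mult.assoc)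
  \<comment> \<open>The error tolerance \<open>c / 2\<close> costs at most half of \<open>q\<close>.
    The resulting radius \<open>r\<close> bounds the admissible \<open>\<epsilon>\<close> and does
    not depend on \<open>\<beta>\<close>.\<close>
  have "\<forall>\<^sub>F w in nhds 0. \<bar>U (u\<^sub>0 + w) - U u\<^sub>0 - q w\<bar> \<le> c / 2 * (norm w)\<^sup>2"
    using c by (intro expand) auto
  then obtain r where r: "0 < r" "\<And>w. norm w < r \<Longrightarrow> \<bar>U (u\<^sub>0 + w) - U u\<^sub>0 - q w\<bar> \<le> c / 2 * (norm w)\<^sup>2"
    by (auto simp: eventually_nhds_metric)
  have lower: "q (p x) / 2 \<le> U (u\<^sub>0 + p x) - U u\<^sub>0" if "norm (p x) < r" for x
    using r(2)[OF that] qc[of x] by linarith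
  show ?thesis
  proof (rule eventually_at_rightI[of 0 r])
    show "0 < r" by (rule r)
    fix \<epsilon> assume "\<epsilon> \<in> {0<..<r}"
    then have \<epsilon>: "0 < \<epsilon>" "\<epsilon> < r" by auto
    \<comment> \<open>The rescaled integrand. The fixed ball of radius \<open>\<epsilon>\<close>
      becomes one of radius \<open>\<epsilon> * sqrt \<beta>\<close>, which exhausts the space, so
      for fixed \<open>x\<close> the indicator is eventually 1.\<close>
    define s where "s \<beta> x = indicator {x. norm (p x) \<le> \<epsilon> * sqrt \<beta>} x
      * exp (- \<beta> * (U (u\<^sub>0 + (1 / sqrt \<beta>) *\<^sub>R p x) - U u\<^sub>0))" for \<beta> x
    have eq: "sqrt \<beta> ^ card B * exp (\<beta> * U u\<^sub>0) *
        (LINT u : cball u\<^sub>0 \<epsilon> | chart_measure u\<^sub>0 B. exp (- \<beta> * U u)) = (LINT x|?M. s \<beta> x)"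
      if \<beta>: "0 < \<beta>" for \<beta>
    proof -
      have m: "(\<lambda>u. indicator (cball u\<^sub>0 \<epsilon>) u *\<^sub>R exp (- \<beta> * U u)) \<in> borel_measurable borel"
        by (intro borel_measurable_scaleR borel_measurable_indicator) simp_all
      let ?f = "\<lambda>x. indicator (cball u\<^sub>0 \<epsilon>) (u\<^sub>0 + p x) * exp (- \<beta> * U (u\<^sub>0 + p x))"
      have "(LINT u : cball u\<^sub>0 \<epsilon> | chart_measure u\<^sub>0 B. exp (- \<beta> * U u)) = (LINT x|?M. ?f x)"
        unfolding set_lebesgue_integral_def chart_measure_def p_def
        by (subst integral_distr[OF chart_measurable[OF fin] m]) simp
      also have "\<dots> = (1 / sqrt \<beta>) ^ card B * (LINT x|?M. ?f (\<lambda>b\<in>B. 1 / sqrt \<beta> * x b))"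
      proof (rule integral_PiM_lborel_scale[OF fin])
        show "?f \<in> borel_measurable ?M"
          using measurable_compose[OF chart_measurable[OF fin] m] by (simp add: p_def)
      qed (use \<beta> in simp_all)
      finally have 1: "(LINT u : cball u\<^sub>0 \<epsilon> | chart_measure u\<^sub>0 B. exp (- \<beta> * U u))
          = (1 / sqrt \<beta>) ^ card B * (LINT x|?M. ?f (\<lambda>b\<in>B. 1 / sqrt \<beta> * x b))" .
      have 2: "exp (\<beta> * U u\<^sub>0) * (LINT x|?M. ?f (\<lambda>b\<in>B. 1 / sqrt \<beta> * x b)) = (LINT x|?M. s \<beta> x)"
        unfolding Bochner_Integration.integral_mult_right_zero[symmetric]
      proof (rule Bochner_Integration.integral_cong[OF refl])
        fix x
        have "indicator (cball u\<^sub>0 \<epsilon>) (u\<^sub>0 + (1 / sqrt \<beta>) *\<^sub>R p x)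
            = (indicator {x. norm (p x) \<le> \<epsilon> * sqrt \<beta>} x :: real)"
          using \<beta> by (simp add: indicator_def dist_norm pos_divide_le_eq)
        moreover have "exp (\<beta> * U u\<^sub>0) * exp (- \<beta> * U (u\<^sub>0 + (1 / sqrt \<beta>) *\<^sub>R p x))
            = exp (- \<beta> * (U (u\<^sub>0 + (1 / sqrt \<beta>) *\<^sub>R p x) - U u\<^sub>0))"
          by (simp add: exp_add[symmetric] right_diff_distrib)
        ultimately show "exp (\<beta> * U u\<^sub>0) * ?f (\<lambda>b\<in>B. 1 / sqrt \<beta> * x b) = s \<beta> x"
          unfolding pt s_def by (metis mult.left_commute)
      qed
      show ?thesis unfolding 1 2[symmetric] using \<beta> by (simp add: power_divide)
    qed
    have "((\<lambda>\<beta>. LINT x|?M. s \<beta> x) \<longlongrightarrow> (LINT x|?M. exp (- (\<Sum>b\<in>B. (x b)\<^sup>2 * q b)))) at_top"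
    proof (rule integral_dominated_convergence_at_top)
      show "\<forall>\<^sub>F \<beta> in at_top. AE x in ?M. norm (s \<beta> x) \<le> exp (- (\<Sum>b\<in>B. (x b)\<^sup>2 * (q b / 2)))"
        using eventually_gt_at_top[of 0]
      proof eventually_elim
        case (elim \<beta>)
        have "norm (s \<beta> x) \<le> exp (- (\<Sum>b\<in>B. (x b)\<^sup>2 * (q b / 2)))" for x
        proof (cases "norm (p x) \<le> \<epsilon> * sqrt \<beta>")
          case True
          moreover have "\<epsilon> * sqrt \<beta> < r * sqrt \<beta>"
            using elim \<epsilon> by simp
          ultimately have "norm (p x) < r * sqrt \<beta>" by linarith
          then have "norm ((1 / sqrt \<beta>) *\<^sub>R p x) < r"
            using elim by (simp add: pos_divide_less_eq)
          then have "q (p x) / 2 \<le> \<beta> * (U (u\<^sub>0 + (1 / sqrt \<beta>) *\<^sub>R p x) - U u\<^sub>0)"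
            using mult_left_mono[OF lower[of "\<lambda>b\<in>B. 1 / sqrt \<beta> * x b", unfolded pt qt], of \<beta>] elim
            by (simp add: power_divide)
          moreover have "(\<Sum>b\<in>B. (x b)\<^sup>2 * (q b / 2)) = q (p x) / 2"
            by (simp add: p_def q sum_divide_distrib)
          ultimately show ?thesis by (simp add: s_def True)
        qed (simp add: s_def)
        then show ?case by simp
      qed
      show "AE x in ?M. ((\<lambda>\<beta>. s \<beta> x) \<longlongrightarrow> exp (- (\<Sum>b\<in>B. (x b)\<^sup>2 * q b))) at_top"
      proof (rule AE_I2)
        fix x
        have inv0: "((\<lambda>\<beta>. (1 / sqrt \<beta>) *\<^sub>R p x) \<longlongrightarrow> 0) at_top"
          using tendsto_scaleR[OF tendsto_divide_0[OF tendsto_const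
              filterlim_at_top_imp_at_infinity[OF sqrt_at_top]] tendsto_const[of "p x"], of 1] by simp
        have "((\<lambda>\<beta>. \<beta> * (U (u\<^sub>0 + (1 / sqrt \<beta>) *\<^sub>R p x) - U u\<^sub>0)) \<longlongrightarrow> q (p x)) at_top"
        proof (rule tendstoI)
          fix e :: real assume "0 < e"
          \<comment> \<open>At the rescaled point the expansion error is
            \<open>\<eta> * (norm (p x))\<^sup>2 / \<beta>\<close>, and multiplication by
            \<open>\<beta>\<close> leaves \<open>\<eta> * (norm (p x))\<^sup>2\<close>. The summand
            1 keeps this strictly below \<open>e\<close> and covers \<open>p x = 0\<close>.\<close>
          define \<eta> where "\<eta> = e / ((norm (p x))\<^sup>2 + 1)"
          have \<eta>: "0 < \<eta>" "\<eta> * (norm (p x))\<^sup>2 < e"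
            using \<open>0 < e\<close> by (simp_all add: \<eta>_def pos_divide_less_eq add_nonneg_pos)
          have "\<forall>\<^sub>F \<beta> in at_top. \<bar>U (u\<^sub>0 + (1 / sqrt \<beta>) *\<^sub>R p x) - U u\<^sub>0 - q ((1 / sqrt \<beta>) *\<^sub>R p x)\<bar>
              \<le> \<eta> * (norm ((1 / sqrt \<beta>) *\<^sub>R p x))\<^sup>2"
            by (rule eventually_compose_filterlim[OF expand[OF \<eta>(1)] inv0])
          then show "\<forall>\<^sub>F \<beta> in at_top. dist (\<beta> * (U (u\<^sub>0 + (1 / sqrt \<beta>) *\<^sub>R p x) - U u\<^sub>0)) (q (p x)) < e"
            using eventually_gt_at_top[of 0]
          proof eventually_elim
            case (elim \<beta>)
            let ?D = "U (u\<^sub>0 + (1 / sqrt \<beta>) *\<^sub>R p x) - U u\<^sub>0"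
            have "\<bar>?D - q (p x) / \<beta>\<bar> \<le> \<eta> * ((norm (p x))\<^sup>2 / \<beta>)"
              using elim by (simp add: qt power_divide power_mult_distrib)
            then have "\<beta> * \<bar>?D - q (p x) / \<beta>\<bar> \<le> \<beta> * (\<eta> * ((norm (p x))\<^sup>2 / \<beta>))"
              using elim by (intro mult_left_mono) auto
            moreover have "\<beta> * \<bar>?D - q (p x) / \<beta>\<bar> = \<bar>\<beta> * (?D - q (p x) / \<beta>)\<bar>"
              using elim by (simp add: abs_mult)
            moreover have "\<beta> * (?D - q (p x) / \<beta>) = \<beta> * ?D - q (p x)"
              using elim by (simp add: right_diff_distrib)
            ultimately show ?case
              using elim \<eta>(2) by (simp add: dist_real_def)
          qed
        qed
        then have "((\<lambda>\<beta>. exp (- (\<beta> * (U (u\<^sub>0 + (1 / sqrt \<beta>) *\<^sub>R p x) - U u\<^sub>0)))) \<longlongrightarrow> exp (- q (p x))) at_top"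
          by (intro tendsto_intros)
        moreover have "\<forall>\<^sub>F \<beta> in at_top. exp (- (\<beta> * (U (u\<^sub>0 + (1 / sqrt \<beta>) *\<^sub>R p x) - U u\<^sub>0))) = s \<beta> x"
        proof -
          have "\<forall>\<^sub>F \<beta> in at_top. dist ((1 / sqrt \<beta>) *\<^sub>R p x) 0 < \<epsilon>"
            using tendstoD[OF inv0 \<epsilon>(1)] .
          then show ?thesis
            using eventually_gt_at_top[of 0]
            by eventually_elim (auto simp: s_def indicator_def field_simps)
        qed
        ultimately have "((\<lambda>\<beta>. s \<beta> x) \<longlongrightarrow> exp (- q (p x))) at_top"
          by (rule Lim_transform_eventually)
        then show "((\<lambda>\<beta>. s \<beta> x) \<longlongrightarrow> exp (- (\<Sum>b\<in>B. (x b)\<^sup>2 * q b))) at_top"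
          by (simp add: p_def q)
      qed
      show "integrable ?M (\<lambda>x. exp (- (\<Sum>b\<in>B. (x b)\<^sup>2 * (q b / 2))))"
        by (rule integral_PiM_gauss) (use q_pos in auto)
      show "\<And>\<beta>. s \<beta> \<in> borel_measurable ?M" unfolding s_def by measurable
    qed measurable
    then have "((\<lambda>\<beta>. LINT x|?M. s \<beta> x) \<longlongrightarrow> (\<Prod>b\<in>B. sqrt (pi / q b))) at_top"
      using q_pos by (simp add: integral_PiM_gauss)
    moreover have "\<forall>\<^sub>F \<beta> in at_top. (LINT x|?M. s \<beta> x) = sqrt \<beta> ^ card B * exp (\<beta> * U u\<^sub>0) *
        (LINT u : cball u\<^sub>0 \<epsilon> | chart_measure u\<^sub>0 B. exp (- \<beta> * U u))"
      using eventually_gt_at_top[of 0] by eventually_elim (simp only: eq)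
    ultimately show "((\<lambda>\<beta>. sqrt \<beta> ^ card B * exp (\<beta> * U u\<^sub>0) *
        (LINT u : cball u\<^sub>0 \<epsilon> | chart_measure u\<^sub>0 B. exp (- \<beta> * U u))) \<longlongrightarrow> (\<Prod>b\<in>B. sqrt (pi / q b))) at_top"
      by (rule Lim_transform_eventually)
  qed
qed

text \<open>The integral over \<open>A\<close> is the ball integral \<open>J\<close> plus a tail
  \<open>K\<close>; concentration forces \<open>K / I\<close> to 0, so \<open>I\<close> inherits the
  asymptotics of \<open>J\<close>. That \<open>A\<close> is a neighbourhood only along
  \<open>W\<close> is deliberate: \<open>A\<close> may be the hyperplane itself, which contains no
  ball of the ambient space.\<close>

lemma laplace:
  fixes U q :: "'a::euclidean_space \<Rightarrow> real"
  assumes B: "orthonormal_basis_of W B" and [measurable]: "U \<in> borel_measurable borel"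
    and q: "\<And>x. q (\<Sum>b\<in>B. x b *\<^sub>R b) = (\<Sum>b\<in>B. (x b)\<^sup>2 * q b)" and q_pos: "\<And>b. b \<in> B \<Longrightarrow> 0 < q b"
    and expand: "\<And>\<eta>. 0 < \<eta> \<Longrightarrow> \<forall>\<^sub>F w in nhds 0. \<bar>U (u\<^sub>0 + w) - U u\<^sub>0 - q w\<bar> \<le> \<eta> * (norm w)\<^sup>2"
    and int: "\<And>\<beta>. 0 < \<beta> \<Longrightarrow> integrable (chart_measure u\<^sub>0 B) (\<lambda>u. exp (- \<beta> * U u))"
    and [measurable]: "A \<in> sets borel"
    and A: "\<forall>\<^sub>F w in nhds 0. w \<in> W \<longrightarrow> u\<^sub>0 + w \<in> A"
    and conc: "concentrated_near (chart_measure u\<^sub>0 B) A U u\<^sub>0"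
  shows "(\<lambda>\<beta>. LINT u : A | chart_measure u\<^sub>0 B. exp (- \<beta> * U u))
    \<sim>[at_top] (\<lambda>\<beta>. exp (- \<beta> * U u\<^sub>0) * (\<Prod>b\<in>B. sqrt (pi / (\<beta> * q b))))"
proof -
  note fin [simp] = orthonormal_basis_of_finite(1)[OF B]
  let ?M = "chart_measure u\<^sub>0 B"
  define L where "L = (\<Prod>b\<in>B. sqrt (pi / q b))"
  have L: "0 < L" unfolding L_def using q_pos by (intro prod_pos) auto
  obtain r where r: "0 < r" "\<And>w. norm w < r \<Longrightarrow> w \<in> W \<Longrightarrow> u\<^sub>0 + w \<in> A"
    using A by (auto simp: eventually_nhds_metric)
  obtain \<epsilon> where \<epsilon>: "0 < \<epsilon>" "\<epsilon> < r"
    and lim: "((\<lambda>\<beta>. sqrt \<beta> ^ card B * exp (\<beta> * U u\<^sub>0) *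
      (LINT u : cball u\<^sub>0 \<epsilon> | ?M. exp (- \<beta> * U u))) \<longlongrightarrow> L) at_top"
  proof -
    have "\<forall>\<^sub>F \<epsilon> in at_right 0. \<epsilon> \<in> {0<..<r}"
      using r(1) by (rule eventually_at_right_real)
    moreover have "\<forall>\<^sub>F \<epsilon> in at_right 0. ((\<lambda>\<beta>. sqrt \<beta> ^ card B * exp (\<beta> * U u\<^sub>0) *
      (LINT u : cball u\<^sub>0 \<epsilon> | ?M. exp (- \<beta> * U u))) \<longlongrightarrow> L) at_top"
      unfolding L_def by (rule laplace_local[OF B _ q q_pos expand]) measurable
    ultimately have "\<forall>\<^sub>F \<epsilon> in at_right 0. \<epsilon> \<in> {0<..<r} \<and> ((\<lambda>\<beta>. sqrt \<beta> ^ card B * exp (\<beta> * U u\<^sub>0) *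
      (LINT u : cball u\<^sub>0 \<epsilon> | ?M. exp (- \<beta> * U u))) \<longlongrightarrow> L) at_top"
      by (rule eventually_conj)
    from eventually_happens[OF this] show ?thesis using that by auto
  qed
  define I where "I \<beta> = (LINT u : A | ?M. exp (- \<beta> * U u))" for \<beta>
  define J where "J \<beta> = (LINT u : cball u\<^sub>0 \<epsilon> | ?M. exp (- \<beta> * U u))" for \<beta>
  define K where "K \<beta> = (LINT u : A \<inter> {u. norm (u - u\<^sub>0) > \<epsilon>} | ?M. exp (- \<beta> * U u))" for \<beta>
  have J_asymp: "J \<sim>[at_top] (\<lambda>\<beta>. exp (- \<beta> * U u\<^sub>0) * (\<Prod>b\<in>B. sqrt (pi / (\<beta> * q b))))"
  proof (rule asymp_equivI')
    have "((\<lambda>\<beta>. sqrt \<beta> ^ card B * exp (\<beta> * U u\<^sub>0) * J \<beta> / L) \<longlongrightarrow> 1) at_top"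
      using tendsto_divide[OF lim tendsto_const[of L]] L unfolding J_def by simp
    moreover have "\<forall>\<^sub>F \<beta> in at_top. sqrt \<beta> ^ card B * exp (\<beta> * U u\<^sub>0) * J \<beta> / L
        = J \<beta> / (exp (- \<beta> * U u\<^sub>0) * (\<Prod>b\<in>B. sqrt (pi / (\<beta> * q b))))"
      using eventually_gt_at_top[of 0]
    proof eventually_elim
      case (elim \<beta>)
      have "(\<Prod>b\<in>B. sqrt (pi / (\<beta> * q b))) = (\<Prod>b\<in>B. sqrt (pi / q b) / sqrt \<beta>)"
        by (intro prod.cong) (simp_all add: real_sqrt_divide real_sqrt_mult)
      also have "\<dots> = L / sqrt \<beta> ^ card B"
        by (simp add: prod_dividef L_def)
      finally have prod_eq: "(\<Prod>b\<in>B. sqrt (pi / (\<beta> * q b))) = L / sqrt \<beta> ^ card B" .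
      show ?case
        unfolding prod_eq using elim L by (simp add: exp_minus field_simps)
    qed
    ultimately show "((\<lambda>\<beta>. J \<beta> / (exp (- \<beta> * U u\<^sub>0) * (\<Prod>b\<in>B. sqrt (pi / (\<beta> * q b))))) \<longlongrightarrow> 1) at_top"
      by (rule Lim_transform_eventually)
  qed
  have IJK: "I \<beta> = J \<beta> + K \<beta>" if "0 < \<beta>" for \<beta>
  proof -
    \<comment> \<open>Additivity over the two pieces needs integrability, because a Bochner integral
      that does not exist has the value 0.\<close>
    have set_int: "set_integrable ?M C (\<lambda>u. exp (- \<beta> * U u))" if "C \<in> sets borel" for C
      using int[OF \<open>0 < \<beta>\<close>] that unfolding set_integrable_def
      by (intro integrable_mult_indicator) (auto simp: chart_measure_def)
    have "I \<beta> = (LINT u : (A \<inter> cball u\<^sub>0 \<epsilon>) \<union> (A \<inter> {u. norm (u - u\<^sub>0) > \<epsilon>}) | ?M. exp (- \<beta> * U u))"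
      unfolding I_def by (rule arg_cong[where f="\<lambda>A. set_lebesgue_integral ?M A _"])
        (auto simp: dist_norm norm_minus_commute)
    also have "\<dots> = (LINT u : A \<inter> cball u\<^sub>0 \<epsilon> | ?M. exp (- \<beta> * U u)) + K \<beta>"
      unfolding K_def by (intro set_integral_Un set_int) (auto simp: dist_norm norm_minus_commute)
    also have "(LINT u : A \<inter> cball u\<^sub>0 \<epsilon> | ?M. exp (- \<beta> * U u)) = J \<beta>"
    proof -
      \<comment> \<open>The ball need not lie in \<open>A\<close>, but the chart measure lives on
        the translate of \<open>W\<close> through \<open>u\<^sub>0\<close>, and there it does since
        \<open>\<epsilon> < r\<close>.\<close>
      have "AE u in ?M. u \<in> A \<or> u \<notin> cball u\<^sub>0 \<epsilon>"
      proof -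
        have "(\<Sum>b\<in>B. x b *\<^sub>R b) \<in> span B" for x
          by (intro span_sum span_scale span_base)
        then have "(\<Sum>b\<in>B. x b *\<^sub>R b) \<in> W" for x
          using B by (simp add: orthonormal_basis_of_def)
        then have "AE x in (\<Pi>\<^sub>M b\<in>B. lborel). u\<^sub>0 + (\<Sum>b\<in>B. x b *\<^sub>R b) \<in> A \<or> u\<^sub>0 + (\<Sum>b\<in>B. x b *\<^sub>R b) \<notin> cball u\<^sub>0 \<epsilon>"
          using r \<epsilon> by (intro AE_I2) (auto simp: dist_norm)
        then show ?thesis
          unfolding chart_measure_def by (subst AE_distr_iff[OF chart_measurable[OF fin]]) auto
      qed
      then show ?thesis
        unfolding J_def set_lebesgue_integral_def
        by (intro integral_cong_AE) (auto simp: indicator_def chart_measure_def)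
    qed
    finally show ?thesis .
  qed
  have K_nonneg: "0 \<le> K \<beta>" for \<beta>
    unfolding K_def set_lebesgue_integral_def by (rule Bochner_Integration.integral_nonneg) simp
  \<comment> \<open>Division by zero gives 0, so where \<open>I\<close> vanishes the concentration
    bound would say nothing. Positivity comes from the positive limit \<open>L\<close> of the
    normalized ball integral.\<close>
  have I_pos: "\<forall>\<^sub>F \<beta> in at_top. 0 < I \<beta>"
    using order_tendstoD(1)[OF lim L] eventually_gt_at_top[of 0]
  proof eventually_elim
    case (elim \<beta>)
    have "0 < J \<beta>"
      unfolding J_def by (rule zero_less_mult_pos[OF elim(1)]) (use elim(2) in simp)
    then show ?case using IJK[of \<beta>] K_nonneg[of \<beta>] elim by simp
  qed
  have "((\<lambda>\<beta>. K \<beta> / I \<beta>) \<longlongrightarrow> 0) at_top"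
  proof -
    obtain k c \<beta>\<^sub>0 where k: "0 < k" "0 < c" "\<forall>\<beta>>\<beta>\<^sub>0. K \<beta> / I \<beta> \<le> k * exp (- c * \<beta>)"
      using conc[unfolded concentrated_near_def, rule_format, OF \<epsilon>(1), folded I_def K_def]
      by (elim exE conjE)
    have lim0: "((\<lambda>\<beta>. k * exp (- c * \<beta>)) \<longlongrightarrow> 0) at_top"
      using k(1,2) by real_asymp
    have upper: "\<forall>\<^sub>F \<beta> in at_top. K \<beta> / I \<beta> \<le> k * exp (- c * \<beta>)"
      using eventually_gt_at_top[of \<beta>\<^sub>0] by eventually_elim (use k(3) in simp)
    have lower: "\<forall>\<^sub>F \<beta> in at_top. 0 \<le> K \<beta> / I \<beta>"
      using I_pos by eventually_elim (simp add: K_nonneg)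
    show ?thesis by (rule tendsto_sandwich[OF lower upper tendsto_const lim0])
  qed
  then have "((\<lambda>\<beta>. 1 - K \<beta> / I \<beta>) \<longlongrightarrow> 1) at_top"
    using tendsto_diff[OF tendsto_const[of 1]] by force
  moreover have "\<forall>\<^sub>F \<beta> in at_top. 1 - K \<beta> / I \<beta> = J \<beta> / I \<beta>"
    using I_pos eventually_gt_at_top[of 0] by eventually_elim (auto simp: IJK field_simps)
  ultimately have "J \<sim>[at_top] I"
    by (intro asymp_equivI') (rule Lim_transform_eventually)
  then have "I \<sim>[at_top] J" by (rule asymp_equiv_symI)
  from asymp_equiv_trans[OF this J_asymp] show ?thesis by (simp add: I_def[abs_def])
qed

subsection \<open>The linearized chain\<close>

lemma site_add: "site bc e (v + w) j = site bc e v j + site bc e w j"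
  by (auto simp: site_def split: boundary.split)

lemma site_scaleR: "site bc e (c *\<^sub>R v) j = c * site bc e v j"
  by (auto simp: site_def split: boundary.split)

lemma bounded_linear_site: "bounded_linear (\<lambda>u. site bc e u j)"
  by (intro linear_conv_bounded_linear[THEN iffD1] linearI) (simp_all add: site_add site_scaleR)

lemma site_sum_eq_inner:
  fixes v w :: "real^'n"
  assumes "bij_betw e {1..CARD('n)} UNIV"
  shows "(\<Sum>j=1..CARD('n). site bc e v j * site bc e w j) = v \<bullet> w"
proof -
  have "v \<bullet> w = (\<Sum>i\<in>UNIV. v $ i * w $ i)" by (simp add: inner_vec_def)
  also have "\<dots> = (\<Sum>j=1..CARD('n). v $ e j * w $ e j)"
    by (rule sum.reindex_bij_betw[OF assms, symmetric])
  finally show ?thesis by (simp add: site_def)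
qed

lemma site_sum_eq_norm:
  fixes v :: "real^'n"
  assumes "bij_betw e {1..CARD('n)} UNIV"
  shows "(\<Sum>j=1..CARD('n). (site bc e v j)\<^sup>2) = (norm v)\<^sup>2"
  using site_sum_eq_inner[OF assms, of bc v v] by (simp only: power2_eq_square power2_norm_eq_inner[unfolded power2_eq_square])

text \<open>The Hessian of \<open>U_N\<close> at \<open>u\<close> as a bilinear form. First
  differences instead of the second difference in \<open>eigenpair\<close> make the symmetry visible
  and match the expansion of the coupling energy.\<close>

definition chain_form ::
    "(real \<Rightarrow> real) \<Rightarrow> real \<Rightarrow> boundary \<Rightarrow> (nat \<Rightarrow> 'n::finite) \<Rightarrow> real^'n \<Rightarrow> real^'n \<Rightarrow> real^'n \<Rightarrow> real" where
  "chain_form V \<delta> bc e u v w =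
     1 / real CARD('n) * (\<Sum>j=1..CARD('n). deriv (deriv V) (site bc e u j) * site bc e v j * site bc e w j) +
     real CARD('n) * (\<Sum>j=0..CARD('n). \<delta>\<^sup>2 * (site bc e v (j + 1) - site bc e v j) *
       (site bc e w (j + 1) - site bc e w j))"

lemma chain_form_commute: "chain_form V \<delta> bc e u v w = chain_form V \<delta> bc e u w v"
  by (simp add: chain_form_def mult.commute mult.left_commute)

lemma linear_chain_form: "linear (chain_form V \<delta> bc e u v)"
proof -
  have "chain_form V \<delta> bc e u v (x + y) = chain_form V \<delta> bc e u v x + chain_form V \<delta> bc e u v y" for x y
    by (simp add: chain_form_def site_add distrib_left add_diff_add sum.distrib)
  moreover have "chain_form V \<delta> bc e u v (c *\<^sub>R x) = c * chain_form V \<delta> bc e u v x" for c x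
    by (simp add: chain_form_def site_scaleR right_diff_distrib[symmetric] distrib_left
      sum_distrib_left mult_ac)
  ultimately show ?thesis by (intro linearI) simp_all
qed

text \<open>The boundary terms stay explicit because they vanish for different reasons: under
  Dirichlet conditions the end values of \<open>b\<close> are 0, under Neumann conditions the end
  differences of \<open>a\<close> are 0.\<close>

lemma summation_by_parts:
  fixes a b :: "nat \<Rightarrow> real"
  shows "(\<Sum>j=0..n. (a (j + 1) - a j) * (b (j + 1) - b j)) =
    - (\<Sum>j=1..n. (a (j - 1) - 2 * a j + a (j + 1)) * b j)
    + (a (n + 1) - a n) * b (n + 1) - (a 1 - a 0) * b 0"
  by (induction n) (simp_all add: algebra_simps)

text \<open>Both boundary conditions make the boundary terms of the summation by parts vanish.\<close>

lemma chain_form_eigenpair: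
  fixes \<phi> w :: "real^'n"
  assumes e: "bij_betw e {1..CARD('n)} UNIV" and \<phi>: "eigenpair V \<delta> bc e u l \<phi>"
  shows "chain_form V \<delta> bc e u \<phi> w = l / real CARD('n) * (\<phi> \<bullet> w)"
proof -
  let ?N = "CARD('n)" and ?s = "site bc e"
  have N: "0 < real ?N" by simp
  have bd: "(?s \<phi> (?N + 1) - ?s \<phi> ?N) * ?s w (?N + 1) = 0" "(?s \<phi> 1 - ?s \<phi> 0) * ?s w 0 = 0"
    by (cases bc; simp add: site_def Suc_leI)+
  have "(\<Sum>j=0..?N. \<delta>\<^sup>2 * (?s \<phi> (j + 1) - ?s \<phi> j) * (?s w (j + 1) - ?s w j))
    = \<delta>\<^sup>2 * (\<Sum>j=0..?N. (?s \<phi> (j + 1) - ?s \<phi> j) * (?s w (j + 1) - ?s w j))"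
    by (simp add: sum_distrib_left mult.assoc)
  also have "\<dots> = \<delta>\<^sup>2 * - (\<Sum>j=1..?N. (?s \<phi> (j - 1) - 2 * ?s \<phi> j + ?s \<phi> (j + 1)) * ?s w j)"
    unfolding summation_by_parts bd by simp
  finally have "real ?N * chain_form V \<delta> bc e u \<phi> w =
     (\<Sum>j=1..?N. deriv (deriv V) (?s u j) * ?s \<phi> j * ?s w j)
     + (real ?N)\<^sup>2 * (\<delta>\<^sup>2 * - (\<Sum>j=1..?N. (?s \<phi> (j - 1) - 2 * ?s \<phi> j + ?s \<phi> (j + 1)) * ?s w j))"
    using N by (simp only: chain_form_def) (simp add: distrib_left right_diff_distrib power2_eq_square)
  also have "\<dots> = (\<Sum>j=1..?N. (- \<delta>\<^sup>2 * (real ?N)\<^sup>2 * (?s \<phi> (j - 1) - 2 * ?s \<phi> j + ?s \<phi> (j + 1))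
          + deriv (deriv V) (?s u j) * ?s \<phi> j) * ?s w j)"
    by (simp add: sum_distrib_left sum.distrib[symmetric] sum_negf[symmetric] algebra_simps)
  also have "\<dots> = (\<Sum>j=1..?N. (l * ?s \<phi> j) * ?s w j)"
    using \<phi> by (intro sum.cong) (simp_all add: eigenpair_def)
  also have "\<dots> = l * (\<phi> \<bullet> w)"
    by (simp add: site_sum_eq_inner[OF e, of bc, symmetric] sum_distrib_left mult.assoc)
  finally show ?thesis using N by (simp add: field_simps)
qed

text \<open>By symmetry of the form, its value at the two eigenvectors is both \<open>l\<close> and
  \<open>l'\<close> times the same multiple of their inner product.\<close>

lemma eigenpair_orthogonal:
  fixes \<phi> \<phi>' :: "real^'n"
  assumes e: "bij_betw e {1..CARD('n)} UNIV"
    and "eigenpair V \<delta> bc e u l \<phi>" "eigenpair V \<delta> bc e u l' \<phi>'" "l \<noteq> l'"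
  shows "\<phi> \<bullet> \<phi>' = 0"
proof -
  have "l / real CARD('n) * (\<phi> \<bullet> \<phi>') = l' / real CARD('n) * (\<phi> \<bullet> \<phi>')"
    using chain_form_eigenpair[OF e assms(2), of \<phi>'] chain_form_eigenpair[OF e assms(3), of \<phi>]
    by (metis chain_form_commute inner_commute)
  with assms(4) show ?thesis by auto
qed

text \<open>Strict monotonicity makes the eigenvalues distinct, hence the eigenvectors orthogonal.
  The index set is left open because the minimizers use all indices and the hyperplane at the saddle
  omits 1. The divisor \<open>CARD('n)\<close> appears because \<open>eigenpair\<close> refers to N
  times the Hessian.\<close>

lemma eigenbasis:
  fixes \<phi> :: "nat \<Rightarrow> real^'n"
  assumes e: "bij_betw e {1..CARD('n)} UNIV"
    and \<phi>: "\<forall>k\<in>K. eigenpair V \<delta> bc e u (l k) (\<phi> k)" and l: "strict_mono_on K l"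
  defines "b \<equiv> \<lambda>k. \<phi> k /\<^sub>R norm (\<phi> k)"
  shows "inj_on b K" and "orthonormal_basis_of (span (b ` K)) (b ` K)"
    and "\<And>k. k \<in> K \<Longrightarrow> chain_form V \<delta> bc e u (b k) (b k) = l k / real CARD('n)"
proof -
  have nz: "\<phi> k \<noteq> 0" if "k \<in> K" for k using bspec[OF \<phi> that] by (simp add: eigenpair_def)
  have orth: "b k \<bullet> b k' = 0" if "k \<in> K" "k' \<in> K" "k \<noteq> k'" for k k'
  proof -
    have "l k \<noteq> l k'" using l that by (metis nat_neq_iff order_less_irrefl strict_mono_onD)
    then show ?thesis
      unfolding b_def using eigenpair_orthogonal[OF e bspec[OF \<phi>] bspec[OF \<phi>], of k k'] that by simp
  qed
  have norm: "norm (b k) = 1" if "k \<in> K" for k using nz[OF that] by (simp add: b_def)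
  show "inj_on b K"
  proof (rule inj_onI, rule ccontr)
    fix k k' assume "k \<in> K" "k' \<in> K" "b k = b k'" "k \<noteq> k'"
    then have "b k \<bullet> b k = 0" using orth[of k k'] by simp
    with norm[OF \<open>k \<in> K\<close>] show False by auto
  qed
  show "orthonormal_basis_of (span (b ` K)) (b ` K)"
    unfolding orthonormal_basis_of_def pairwise_def orthogonal_def using orth norm by auto
  fix k assume k: "k \<in> K"
  have "chain_form V \<delta> bc e u (\<phi> k) (b k) = l k / real CARD('n) * (\<phi> k \<bullet> b k)"
    by (rule chain_form_eigenpair[OF e bspec[OF \<phi> k]])
  then have "chain_form V \<delta> bc e u (b k) (\<phi> k) = l k / real CARD('n) * norm (\<phi> k)"
    using nz[OF k] by (simp add: b_def chain_form_commute norm_eq_sqrt_inner[symmetric]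
      power2_norm_eq_inner[symmetric] power2_eq_square)
  then show "chain_form V \<delta> bc e u (b k) (b k) = l k / real CARD('n)"
    using nz[OF k] linear_cmul[OF linear_chain_form[of V \<delta> bc e u "b k"], of "inverse (norm (\<phi> k))" "\<phi> k"]
    by (simp add: b_def)
qed

text \<open>Applying the form to an eigenvector is a multiple of the inner product, so orthogonality
  also kills its off-diagonal entries. This supplies the diagonal form that the Laplace lemmas
  assume.\<close>

lemma chain_form_eigenbasis_sum:
  fixes \<phi> :: "nat \<Rightarrow> real^'n"
  assumes e: "bij_betw e {1..CARD('n)} UNIV" and fin: "finite K"
    and \<phi>: "\<forall>k\<in>K. eigenpair V \<delta> bc e u (l k) (\<phi> k)" and l: "strict_mono_on K l"
  defines "B \<equiv> (\<lambda>k. \<phi> k /\<^sub>R norm (\<phi> k)) ` K"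
  shows "chain_form V \<delta> bc e u (\<Sum>b\<in>B. x b *\<^sub>R b) (\<Sum>b\<in>B. x b *\<^sub>R b)
    = (\<Sum>b\<in>B. (x b)\<^sup>2 * chain_form V \<delta> bc e u b b)"
proof -
  let ?F = "chain_form V \<delta> bc e u"
  have finB: "finite B" using fin by (simp add: B_def)
  have lin: "?F v (\<Sum>b\<in>B. x b *\<^sub>R b) = (\<Sum>b\<in>B. x b * ?F v b)" for v
    by (simp add: linear_sum[OF linear_chain_form] linear_cmul[OF linear_chain_form])
  have off: "?F b b' = 0" if bb': "b \<in> B" "b' \<in> B" "b \<noteq> b'" for b b'
  proof -
    obtain k k' where k: "k \<in> K" "b = \<phi> k /\<^sub>R norm (\<phi> k)" "k' \<in> K" "b' = \<phi> k' /\<^sub>R norm (\<phi> k')"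
      using bb' by (auto simp: B_def)
    have "b \<bullet> b' = 0"
      using eigenbasis(2)[OF e \<phi> l] bb' unfolding B_def orthonormal_basis_of_def pairwise_def orthogonal_def
      by blast
    then have "?F (\<phi> k) b' = 0"
      using chain_form_eigenpair[OF e bspec[OF \<phi> k(1)], of b'] k bspec[OF \<phi> k(1)] by (auto simp: eigenpair_def)
    then show ?thesis
      unfolding k(2) by (simp add: chain_form_commute[of _ _ _ _ _ _ b'] linear_cmul[OF linear_chain_form])
  qed
  have "?F (\<Sum>b\<in>B. x b *\<^sub>R b) (\<Sum>b\<in>B. x b *\<^sub>R b) = (\<Sum>b\<in>B. x b * (\<Sum>b'\<in>B. x b' * ?F b b'))"
    unfolding lin by (intro sum.cong refl arg_cong2[where f="(*)"])
      (simp add: lin chain_form_commute[of _ _ _ _ _ "\<Sum>b\<in>B. x b *\<^sub>R b"])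
  also have "\<dots> = (\<Sum>b\<in>B. \<Sum>b'\<in>B. if b' = b then (x b)\<^sup>2 * ?F b b else 0)"
    unfolding sum_distrib_left by (intro sum.cong refl) (auto simp: off power2_eq_square)
  also have "\<dots> = (\<Sum>b\<in>B. (x b)\<^sup>2 * ?F b b)"
    using finB by simp
  finally show ?thesis .
qed

section \<open>Second-order expansion and growth of the potential energy\<close>

lemma double_well_deriv:
  assumes "double_well V"
  shows "(V has_real_derivative deriv V x) (at x)" "(deriv V has_real_derivative deriv (deriv V) x) (at x)"
    "isCont (deriv (deriv V)) x"
proof -
  have "(deriv ^^ k) V differentiable (at x)" for k x
    using assms by (auto simp: double_well_def)
  from this[of 0] this[of 1] this[of 2]
  have d: "V differentiable (at x)" "deriv V differentiable (at x)" "deriv (deriv V) differentiable (at x)" for x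
    by (simp_all add: numeral_2_eq_2)
  then show "(V has_real_derivative deriv V x) (at x)" "(deriv V has_real_derivative deriv (deriv V) x) (at x)"
    by (simp_all add: DERIV_deriv_iff_real_differentiable)
  show "isCont (deriv (deriv V)) x"
    using d(3) by (rule differentiable_imp_continuous_within)
qed

text \<open>The Lagrange remainder evaluates \<open>f''\<close> between \<open>a\<close> and
  \<open>a + s\<close>, and continuity at \<open>a\<close> replaces this value by
  \<open>f'' a\<close>.\<close>

lemma second_order_expansion:
  fixes f :: "real \<Rightarrow> real"
  assumes f: "\<And>x. (f has_real_derivative f' x) (at x)" "\<And>x. (f' has_real_derivative f'' x) (at x)"
    and cont: "isCont f'' a" and "0 < \<eta>"
  shows "\<forall>\<^sub>F s in nhds 0. \<bar>f (a + s) - f a - f' a * s - f'' a / 2 * s\<^sup>2\<bar> \<le> \<eta> * s\<^sup>2"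
proof -
  \<comment> \<open>The tolerance \<open>2 * \<eta>\<close> compensates the factor 1/2 of the
    quadratic Taylor term.\<close>
  have "\<forall>\<^sub>F x in nhds a. dist (f'' x) (f'' a) < 2 * \<eta>"
    using cont \<open>0 < \<eta>\<close> by (intro tendstoD) (auto simp: continuous_at_imp_continuous_at_within isCont_def tendsto_at_iff_tendsto_nhds)
  then obtain d where d: "0 < d" "\<And>x. \<bar>x - a\<bar> < d \<Longrightarrow> \<bar>f'' x - f'' a\<bar> < 2 * \<eta>"
    by (auto simp: eventually_nhds_metric dist_real_def)
  have "\<bar>f (a + s) - f a - f' a * s - f'' a / 2 * s\<^sup>2\<bar> \<le> \<eta> * s\<^sup>2" if s: "\<bar>s\<bar> < d" for s
  proof (cases "s = 0")
    case False
    define diff where "diff n = (if n = 0 then f else if n = 1 then f' else f'')" for n :: nat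
    have "\<exists>t. (if a + s < a then a + s < t \<and> t < a else a < t \<and> t < a + s) \<and>
        f (a + s) = (\<Sum>m<2. diff m a / fact m * (a + s - a) ^ m) + diff 2 t / fact 2 * (a + s - a) ^ 2"
      by (rule Taylor[where a="a - \<bar>s\<bar>" and b="a + \<bar>s\<bar>"])
        (use False f in \<open>auto simp: diff_def less_Suc_eq numeral_2_eq_2\<close>)
    then obtain t where "if a + s < a then a + s < t \<and> t < a else a < t \<and> t < a + s"
      and f_t: "f (a + s) = (\<Sum>m<2. diff m a / fact m * (a + s - a) ^ m) + diff 2 t / fact 2 * (a + s - a) ^ 2"
      by blast
    then have t: "\<bar>t - a\<bar> < \<bar>s\<bar>" "f (a + s) = f a + f' a * s + f'' t / 2 * s\<^sup>2"
      by (auto simp: diff_def lessThan_nat_numeral split: if_splits)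
    have "\<bar>f (a + s) - f a - f' a * s - f'' a / 2 * s\<^sup>2\<bar> = \<bar>f'' t - f'' a\<bar> / 2 * s\<^sup>2"
      unfolding t(2) by (simp add: abs_mult left_diff_distrib[symmetric] diff_divide_distrib[symmetric])
    also have "\<dots> \<le> \<eta> * s\<^sup>2"
      using d(2)[of t] t(1) s by (intro mult_right_mono) auto
    finally show ?thesis .
  qed simp
  then show ?thesis
    using d(1) by (auto simp: eventually_nhds_metric dist_real_def)
qed

lemma U_N_has_derivative:
  fixes u :: "real^'n"
  assumes "double_well V"
  shows "(U_N V \<delta> bc e has_derivative (\<lambda>w.
      1 / real CARD('n) * (\<Sum>j=1..CARD('n). deriv V (site bc e u j) * site bc e w j) +
      real CARD('n) * (\<Sum>j=0..CARD('n). \<delta>\<^sup>2 * (site bc e u (j + 1) - site bc e u j) *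
        (site bc e w (j + 1) - site bc e w j)))) (at u)"
proof -
  have site: "((\<lambda>u. site bc e u j) has_derivative (\<lambda>w. site bc e w j)) (at u)" for j
    by (rule bounded_linear_imp_has_derivative[OF bounded_linear_site])
  have V: "((\<lambda>u. V (site bc e u j)) has_derivative (\<lambda>w. deriv V (site bc e u j) * site bc e w j)) (at u)" for j
    using DERIV_compose_FDERIV[OF double_well_deriv(1)[OF assms] site] by (simp add: mult.commute)
  have sq: "((\<lambda>u. 1 / 2 * \<delta>\<^sup>2 * (site bc e u (j + 1) - site bc e u j)\<^sup>2) has_derivative
     (\<lambda>w. \<delta>\<^sup>2 * (site bc e u (j + 1) - site bc e u j) * (site bc e w (j + 1) - site bc e w j))) (at u)" for j
    by (auto intro!: derivative_eq_intros site simp: fun_eq_iff field_simps)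
  show ?thesis
    unfolding U_N_def[abs_def]
    by (intro has_derivative_add has_derivative_mult_right has_derivative_sum V sq)
qed

lemma U_N_measurable:
  assumes "double_well V"
  shows "U_N V \<delta> bc e \<in> borel_measurable borel"
proof (rule borel_measurable_continuous_onI, rule continuous_at_imp_continuous_on, rule ballI)
  fix u show "isCont (U_N V \<delta> bc e) u"
    by (rule has_derivative_continuous[OF U_N_has_derivative[OF assms]])
qed

text \<open>The coupling energy is quadratic and expands exactly (\<open>poly\<close>), so the whole
  error is the average \<open>1 / N\<close> of the N remainders \<open>R\<close> of
  \<open>V\<close>. The squared site values sum to the squared norm, which turns the one-dimensional
  bounds into the claim.\<close>

lemma U_N_expansion:
  fixes u :: "real^'n"
  assumes e: "bij_betw e {1..CARD('n)} UNIV" and V: "double_well V"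
    and crit: "critical_point (U_N V \<delta> bc e) u" and "0 < \<eta>"
  shows "\<forall>\<^sub>F w in nhds 0. \<bar>U_N V \<delta> bc e (u + w) - U_N V \<delta> bc e u - chain_form V \<delta> bc e u w w / 2\<bar>
    \<le> \<eta> * (norm w)\<^sup>2"
proof -
  let ?N = "CARD('n)" and ?s = "site bc e"
  define D where "D w = 1 / real ?N * (\<Sum>j=1..?N. deriv V (?s u j) * ?s w j) +
      real ?N * (\<Sum>j=0..?N. \<delta>\<^sup>2 * (?s u (j + 1) - ?s u j) * (?s w (j + 1) - ?s w j))" for w
  \<comment> \<open>\<open>D\<close> is the derivative of \<open>U_N\<close> at \<open>u\<close>; at
    a critical point uniqueness of the derivative makes it vanish.\<close>
  have D0: "D w = 0" for w
    using has_derivative_unique[OF U_N_has_derivative[OF V, of \<delta> bc e u] crit[unfolded critical_point_def]]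
    unfolding D_def by (rule fun_cong)
  have poly: "1 / 2 * c * (x + y)\<^sup>2 - 1 / 2 * c * x\<^sup>2 - c * x * y - c * y * y / 2 = 0" for c x y :: real
    by (simp add: power2_eq_square field_simps)
  define R where "R w j = V (?s u j + ?s w j) - V (?s u j) - deriv V (?s u j) * ?s w j
      - deriv (deriv V) (?s u j) / 2 * (?s w j)\<^sup>2" for w j
  have eq: "U_N V \<delta> bc e (u + w) - U_N V \<delta> bc e u - chain_form V \<delta> bc e u w w / 2
     = 1 / real ?N * (\<Sum>j=1..?N. R w j)" for w
  proof -
    have "U_N V \<delta> bc e (u + w) - U_N V \<delta> bc e u - D w - chain_form V \<delta> bc e u w w / 2
       = 1 / real ?N * ((\<Sum>j=1..?N. V (?s (u + w) j)) - (\<Sum>j=1..?N. V (?s u j))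
          - (\<Sum>j=1..?N. deriv V (?s u j) * ?s w j) - (\<Sum>j=1..?N. deriv (deriv V) (?s u j) * ?s w j * ?s w j) / 2)
       + real ?N * ((\<Sum>j=0..?N. 1/2 * \<delta>\<^sup>2 * (?s (u + w) (j + 1) - ?s (u + w) j)\<^sup>2)
          - (\<Sum>j=0..?N. 1/2 * \<delta>\<^sup>2 * (?s u (j + 1) - ?s u j)\<^sup>2)
          - (\<Sum>j=0..?N. \<delta>\<^sup>2 * (?s u (j + 1) - ?s u j) * (?s w (j + 1) - ?s w j))
          - (\<Sum>j=0..?N. \<delta>\<^sup>2 * (?s w (j + 1) - ?s w j) * (?s w (j + 1) - ?s w j)) / 2)"
      unfolding U_N_def D_def chain_form_def by (simp only: right_diff_distrib distrib_left) argo
    also have "(\<Sum>j=1..?N. V (?s (u + w) j)) - (\<Sum>j=1..?N. V (?s u j))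
          - (\<Sum>j=1..?N. deriv V (?s u j) * ?s w j) - (\<Sum>j=1..?N. deriv (deriv V) (?s u j) * ?s w j * ?s w j) / 2
       = (\<Sum>j=1..?N. R w j)"
      unfolding R_def sum_subtractf sum_divide_distrib by (simp add: site_add power2_eq_square mult.assoc)
    also have "(\<Sum>j=0..?N. 1/2 * \<delta>\<^sup>2 * (?s (u + w) (j + 1) - ?s (u + w) j)\<^sup>2)
          - (\<Sum>j=0..?N. 1/2 * \<delta>\<^sup>2 * (?s u (j + 1) - ?s u j)\<^sup>2)
          - (\<Sum>j=0..?N. \<delta>\<^sup>2 * (?s u (j + 1) - ?s u j) * (?s w (j + 1) - ?s w j))
          - (\<Sum>j=0..?N. \<delta>\<^sup>2 * (?s w (j + 1) - ?s w j) * (?s w (j + 1) - ?s w j)) / 2 = 0"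
      unfolding sum_divide_distrib sum_subtractf[symmetric]
      by (intro sum.neutral ballI) (simp only: site_add add_diff_add poly)
    finally show ?thesis by (simp add: D0)
  qed
  have "\<forall>\<^sub>F w in nhds 0. \<forall>j\<in>{1..?N}. \<bar>R w j\<bar> \<le> \<eta> * (?s w j)\<^sup>2"
  proof (intro eventually_ball_finite ballI)
    fix j
    have "filterlim (\<lambda>w. ?s w j) (nhds (?s 0 j)) (nhds 0)"
      by (rule tendsto_at_iff_tendsto_nhds[THEN iffD1, OF
            isContD[OF bounded_linear.isCont[OF bounded_linear_site continuous_ident]]])
    moreover have "?s 0 j = 0" using site_scaleR[of bc e 0 0 j] by simp
    ultimately have "filterlim (\<lambda>w. ?s w j) (nhds 0) (nhds 0)" by simp
    then show "\<forall>\<^sub>F w in nhds 0. \<bar>R w j\<bar> \<le> \<eta> * (?s w j)\<^sup>2"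
      unfolding R_def
      by (rule eventually_compose_filterlim[OF second_order_expansion[OF double_well_deriv[OF V] \<open>0 < \<eta>\<close>]])
  qed simp
  then show ?thesis
  proof eventually_elim
    case (elim w)
    have "\<bar>1 / real ?N * (\<Sum>j=1..?N. R w j)\<bar> \<le> 1 / real ?N * (\<Sum>j=1..?N. \<eta> * (?s w j)\<^sup>2)"
      using elim by (auto simp: abs_mult intro!: divide_right_mono order_trans[OF sum_abs] sum_mono)
    also have "\<dots> = 1 / real ?N * (\<eta> * (norm w)\<^sup>2)"
      by (simp only: sum_distrib_left[symmetric] site_sum_eq_norm[OF e])
    also have "\<dots> \<le> 1 * (\<eta> * (norm w)\<^sup>2)"
      using \<open>0 < \<eta>\<close> by (intro mult_right_mono) (auto simp: divide_simps Suc_leI)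
    finally show ?case unfolding eq by simp
  qed
qed

text \<open>The coupling energy is nonnegative, so the quadratic growth of \<open>V\<close> passes
  to the sum. This coercivity gives integrability of the Boltzmann weight for every positive
  \<open>\<beta>\<close>.\<close>

lemma U_N_lower_bound:
  assumes e: "bij_betw e {1..CARD('n)} UNIV" and V: "double_well V"
  obtains a d where "0 < a" "\<And>u :: real^'n. a * (norm u)\<^sup>2 - d \<le> U_N V \<delta> bc e u"
proof -
  let ?N = "CARD('n)"
  obtain C r m where C: "0 < C" and m: "\<And>x. m \<le> V x" and r: "\<And>x. r \<le> \<bar>x\<bar> \<Longrightarrow> C * x\<^sup>2 \<le> V x"
    using V by (auto simp: double_well_def eventually_at_infinity)
  \<comment> \<open>Inside radius \<open>r\<close> the term \<open>C * r\<^sup>2\<close> absorbs the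
    parabola and \<open>\<bar>m\<bar>\<close> the lower bound of \<open>V\<close>; outside only
    \<open>0 \<le> d\<close> matters.\<close>
  define d where "d = C * r\<^sup>2 + \<bar>m\<bar>"
  have Vd: "C * x\<^sup>2 - d \<le> V x" for x
  proof (cases "r \<le> \<bar>x\<bar>")
    case True
    have "0 \<le> d" using C by (simp add: d_def)
    with r[OF True] show ?thesis by simp
  next
    case False
    then have "C * x\<^sup>2 \<le> C * r\<^sup>2" using C abs_le_square_iff[of x r] by auto
    with m[of x] show ?thesis by (simp add: d_def)
  qed
  have "C / real ?N * (norm u)\<^sup>2 - d \<le> U_N V \<delta> bc e u" for u :: "real^'n"
  proof -
    have "C / real ?N * (norm u)\<^sup>2 - d = 1 / real ?N * (\<Sum>j=1..?N. C * (site bc e u j)\<^sup>2 - d)"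
      by (simp add: sum_subtractf sum_distrib_left[symmetric] site_sum_eq_norm[OF e, unfolded One_nat_def] diff_divide_distrib)
    also have "\<dots> \<le> 1 / real ?N * (\<Sum>j=1..?N. V (site bc e u j))"
      by (intro mult_left_mono sum_mono Vd) auto
    also have "\<dots> \<le> U_N V \<delta> bc e u"
      unfolding U_N_def by (auto intro!: mult_nonneg_nonneg sum_nonneg)
    finally show ?thesis .
  qed
  then show thesis using C by (intro that[of "C / real ?N" d]) auto
qed

subsection \<open>Asymptotics of the phase space integrals\<close>

text \<open>Substitution of \<open>sqrt a * t\<close> in the half-line first moment of the Gaussian,
  whose value is 1/2. With \<open>a = \<beta> / (2 N)\<close> this is the flux factor
  \<open>N / \<beta>\<close>.\<close>

lemma integral_half_gauss:
  assumes "0 < a"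
  shows "integrable lborel (\<lambda>t::real. max t 0 * exp (- (t\<^sup>2 * a)))"
    and "(LINT t|lborel. max t 0 * exp (- (t\<^sup>2 * a))) = 1 / (2 * a)"
proof -
  let ?c = "sqrt a"
  have "has_bochner_integral lborel (\<lambda>t::real. max t 0 * exp (- t\<^sup>2)) (1 / 2)"
    by (rule has_bochner_integral_cong[THEN iffD1, OF _ _ _ gaussian_moment_1])
      (auto simp: indicator_def max_def)
  then have "has_bochner_integral lborel (\<lambda>t. max (0 + ?c * t) 0 * exp (- (0 + ?c * t)\<^sup>2)) ((1 / 2) /\<^sub>R \<bar>?c\<bar>)"
    using assms by (subst lborel_has_bochner_integral_real_affine_iff[of ?c, symmetric]) auto
  then have "has_bochner_integral lborel (\<lambda>t. (1 / ?c) * (max (0 + ?c * t) 0 * exp (- (0 + ?c * t)\<^sup>2)))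
      ((1 / ?c) * ((1 / 2) /\<^sub>R \<bar>?c\<bar>))"
    by (rule has_bochner_integral_mult_right)
  moreover have "(1 / ?c) * (max (0 + ?c * t) 0 * exp (- (0 + ?c * t)\<^sup>2)) = max t 0 * exp (- (t\<^sup>2 * a))" for t
  proof -
    have "max (?c * t) 0 = ?c * max t 0" using assms by (simp add: max_def zero_le_mult_iff mult_le_0_iff)
    then show ?thesis using assms by (simp add: power_mult_distrib mult.commute)
  qed
  moreover have "(1 / ?c) * ((1 / 2) /\<^sub>R \<bar>?c\<bar>) = 1 / (2 * a)"
    using assms by (simp add: field_simps)
  ultimately have "has_bochner_integral lborel (\<lambda>t. max t 0 * exp (- (t\<^sup>2 * a))) (1 / (2 * a))"
    by simp
  then show "integrable lborel (\<lambda>t::real. max t 0 * exp (- (t\<^sup>2 * a)))"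
    "(LINT t|lborel. max t 0 * exp (- (t\<^sup>2 * a))) = 1 / (2 * a)"
    by (simp_all add: has_bochner_integral_iff)
qed

lemma lborel_integral_orthonormal:
  fixes f :: "'a::euclidean_space \<Rightarrow> real"
  assumes B: "orthonormal_basis_of UNIV B" and f: "f \<in> borel_measurable borel"
  shows "(LINT p|lborel. f p) = (LINT x|(\<Pi>\<^sub>M b\<in>B. lborel). f (\<Sum>b\<in>B. x b *\<^sub>R b))"
proof -
  note fin = orthonormal_basis_of_finite(1)[OF B]
  have "(LINT p|lborel. f p) = (LINT p|chart_measure 0 B. f p)"
    by (simp only: chart_measure_UNIV[OF B])
  also have "\<dots> = (LINT x|(\<Pi>\<^sub>M b\<in>B. lborel). f (0 + (\<Sum>b\<in>B. x b *\<^sub>R b)))"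
    unfolding chart_measure_def by (rule integral_distr[OF chart_measurable[OF fin] f])
  finally show ?thesis by simp
qed

lemma orthonormal_sum_inner:
  assumes B: "orthonormal_basis_of W B" and n: "n \<in> B"
  shows "(\<Sum>b\<in>B. x b *\<^sub>R b) \<bullet> n = x n"
proof -
  have "b \<bullet> n = (if b = n then 1 else 0)" if "b \<in> B" for b
    using B that n by (auto simp: orthonormal_basis_of_def pairwise_def orthogonal_def norm_eq_1)
  then have "(\<Sum>b\<in>B. x b *\<^sub>R b) \<bullet> n = (\<Sum>b\<in>B. if b = n then x b else 0)"
    unfolding inner_sum_left by (intro sum.cong) auto
  also have "\<dots> = x n" using orthonormal_basis_of_finite(1)[OF B] n by simp
  finally show ?thesis .
qed

lemma integral_gauss_euclidean:
  assumes "0 < a"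
  shows "(LINT p|(lborel :: 'a::euclidean_space measure). exp (- (a * (norm p)\<^sup>2))) = sqrt (pi / a) ^ DIM('a)"
proof -
  have "(LINT p|(lborel :: 'a measure). exp (- (a * (norm p)\<^sup>2)))
      = (LINT x|(\<Pi>\<^sub>M b\<in>(Basis :: 'a set). lborel). exp (- (\<Sum>b\<in>Basis. (x b)\<^sup>2 * a)))"
    by (subst lborel_integral_orthonormal[OF orthonormal_basis_of_Basis])
      (auto simp: norm_chart_sq[OF orthonormal_basis_of_Basis] sum_distrib_left mult.commute)
  then show ?thesis using assms by (simp add: integral_PiM_gauss)
qed

text \<open>In an orthonormal basis containing \<open>n\<close> the flux
  \<open>p \<bullet> n\<close> is a single coordinate, so the integrand is a product and only the
  factor at \<open>n\<close> differs from a plain Gaussian.\<close>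

lemma integral_half_gauss_euclidean:
  fixes n :: "'a::euclidean_space"
  assumes a: "0 < a" and B: "orthonormal_basis_of UNIV B" and n: "n \<in> B"
  shows "(LINT p|lborel. max (p \<bullet> n) 0 * exp (- (a * (norm p)\<^sup>2)))
    = 1 / (2 * a) * sqrt (pi / a) ^ (DIM('a) - 1)"
proof -
  note fin = orthonormal_basis_of_finite(1)[OF B]
  have card: "card B = DIM('a)" using orthonormal_basis_of_finite(2)[OF B] by simp
  define g where "g b t = (if b = n then max t 0 else 1) * exp (- (t\<^sup>2 * a))" for b :: 'a and t :: real
  have "(LINT p|lborel. max (p \<bullet> n) 0 * exp (- (a * (norm p)\<^sup>2)))
     = (LINT x|(\<Pi>\<^sub>M b\<in>B. lborel). max (x n) 0 * exp (- (\<Sum>b\<in>B. (x b)\<^sup>2 * a)))"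
    by (subst lborel_integral_orthonormal[OF B])
      (auto simp: orthonormal_sum_inner[OF B n] norm_chart_sq[OF B] sum_distrib_left mult.commute)
  also have "\<dots> = (LINT x|(\<Pi>\<^sub>M b\<in>B. lborel). (\<Prod>b\<in>B. g b (x b)))"
    by (simp add: g_def prod.distrib fin n exp_sum sum_negf[symmetric])
  also have "\<dots> = (\<Prod>b\<in>B. LINT t|lborel. g b t)"
  proof (rule lborel_prod.product_integral_prod[OF fin])
    fix b
    show "integrable lborel (g b)"
      using integral_half_gauss(1)[OF a] integral_gauss(1)[OF a]
      by (cases "b = n") (simp_all add: g_def[abs_def])
  qed
  also have "\<dots> = (\<Prod>b\<in>B. if b = n then 1 / (2 * a) else sqrt (pi / a))"
    using a by (intro prod.cong) (auto simp: g_def integral_half_gauss integral_gauss)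
  also have "\<dots> = 1 / (2 * a) * (\<Prod>b\<in>B - {n}. sqrt (pi / a))"
    by (subst prod.remove[OF fin n]) (auto intro!: arg_cong2[where f="(*)"] prod.cong)
  finally show ?thesis using n by (simp add: card)
qed

text \<open>The growth bound is centred at 0 and the chart at \<open>u\<^sub>0\<close>; the
  inequality (s + t)^2 <= 2 s^2 + 2 t^2 for norms moves the centre at the price of half the rate and
  a constant factor.\<close>

lemma chart_integrable_exp:
  fixes U :: "'a::euclidean_space \<Rightarrow> real"
  assumes B: "orthonormal_basis_of W B" and [measurable]: "U \<in> borel_measurable borel"
    and a: "0 < a" and lower: "\<And>u. a * (norm u)\<^sup>2 - d \<le> U u" and \<beta>: "0 < \<beta>"
  shows "integrable (chart_measure u\<^sub>0 B) (\<lambda>u. exp (- \<beta> * U u))"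
proof -
  note fin = orthonormal_basis_of_finite(1)[OF B]
  let ?M = "\<Pi>\<^sub>M b\<in>B. (lborel :: real measure)"
  define p where "p x = (\<Sum>b\<in>B. x b *\<^sub>R b)" for x
  have m: "(\<lambda>u. exp (- \<beta> * U u)) \<in> borel_measurable borel" by measurable
  have bound: "exp (- \<beta> * U (u\<^sub>0 + p x)) \<le>
      exp (\<beta> * (d + a * (norm u\<^sub>0)\<^sup>2)) * exp (- (\<Sum>b\<in>B. (x b)\<^sup>2 * (\<beta> * a / 2)))" for x
  proof -
    have "norm (p x) \<le> norm (u\<^sub>0 + p x) + norm u\<^sub>0"
      using norm_triangle_ineq4[of "u\<^sub>0 + p x" u\<^sub>0] by simp
    then have "(norm (p x))\<^sup>2 \<le> (norm (u\<^sub>0 + p x) + norm u\<^sub>0)\<^sup>2"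
      by (intro power_mono) auto
    also have "\<dots> \<le> 2 * (norm (u\<^sub>0 + p x))\<^sup>2 + 2 * (norm u\<^sub>0)\<^sup>2"
      using zero_le_power2[of "norm (u\<^sub>0 + p x) - norm u\<^sub>0"] by (simp add: power2_sum power2_diff)
    finally have "a * ((norm (p x))\<^sup>2 / 2 - (norm u\<^sub>0)\<^sup>2) \<le> a * (norm (u\<^sub>0 + p x))\<^sup>2"
      using a by (intro mult_left_mono) auto
    also have "\<dots> \<le> U (u\<^sub>0 + p x) + d" using lower[of "u\<^sub>0 + p x"] by simp
    finally have "\<beta> * (a * ((norm (p x))\<^sup>2 / 2 - (norm u\<^sub>0)\<^sup>2)) \<le> \<beta> * (U (u\<^sub>0 + p x) + d)"
      using \<beta> by (intro mult_left_mono) auto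
    moreover have "(\<Sum>b\<in>B. (x b)\<^sup>2 * (\<beta> * a / 2)) = \<beta> * a / 2 * (norm (p x))\<^sup>2"
      unfolding p_def norm_chart_sq[OF B] by (simp add: sum_distrib_left mult.commute)
    ultimately show ?thesis
      by (simp add: exp_add[symmetric] algebra_simps)
  qed
  have "integrable ?M (\<lambda>x. exp (- \<beta> * U (u\<^sub>0 + p x)))"
  proof (rule Bochner_Integration.integrable_bound)
    show "integrable ?M (\<lambda>x. exp (\<beta> * (d + a * (norm u\<^sub>0)\<^sup>2)) * exp (- (\<Sum>b\<in>B. (x b)\<^sup>2 * (\<beta> * a / 2))))"
      using a \<beta> by (intro integrable_mult_right integral_PiM_gauss fin) auto
    show "(\<lambda>x. exp (- \<beta> * U (u\<^sub>0 + p x))) \<in> borel_measurable ?M"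
      using measurable_compose[OF chart_measurable[OF fin, of u\<^sub>0] m] by (simp add: p_def)
  qed (use bound in auto)
  then show ?thesis
    unfolding chart_measure_def p_def by (subst integrable_distr_eq[OF chart_measurable[OF fin] m]) simp
qed

section \<open>Laplace asymptotics at the critical points of the chain\<close>

lemma local_minimizer_critical:
  fixes u :: "real^'n"
  assumes "double_well V" "local_minimizer (U_N V \<delta> bc e) u"
  shows "critical_point (U_N V \<delta> bc e) u"
proof -
  obtain S where S: "open S" "u \<in> S" "\<forall>y\<in>S. U_N V \<delta> bc e u \<le> U_N V \<delta> bc e y"
    using assms(2) by (auto simp: local_minimizer_def eventually_nhds)
  note der = U_N_has_derivative[OF assms(1), of \<delta> bc e u]
  from differential_zero_maxmin[OF S(2,1) der] S(3) der show ?thesis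
    by (simp add: critical_point_def)
qed

text \<open>Here \<open>q\<close> is half the Hessian, with value \<open>l k / (2 N)\<close> at the
  k-th unit eigenvector, whence the factor \<open>sqrt (2 pi N / (\<beta> * l k))\<close>.
  Positivity is asked only on \<open>K\<close>, so the saddle is covered by leaving out the index
  1.\<close>

lemma laplace_chain:
  fixes u\<^sub>0 :: "real^'n" and \<phi> :: "nat \<Rightarrow> real^'n"
  assumes e: "bij_betw e {1..CARD('n)} UNIV" and V: "double_well V"
    and crit: "critical_point (U_N V \<delta> bc e) u\<^sub>0" and fin: "finite K"
    and \<phi>: "\<forall>k\<in>K. eigenpair V \<delta> bc e u\<^sub>0 (l k) (\<phi> k)" and l: "strict_mono_on K l"
    and l_pos: "\<forall>k\<in>K. 0 < l k"
  defines "B \<equiv> (\<lambda>k. \<phi> k /\<^sub>R norm (\<phi> k)) ` K"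
  assumes A: "A \<in> sets borel" "\<forall>\<^sub>F w in nhds 0. w \<in> span B \<longrightarrow> u\<^sub>0 + w \<in> A"
    and conc: "concentrated_near (chart_measure u\<^sub>0 B) A (U_N V \<delta> bc e) u\<^sub>0"
  shows "(\<lambda>\<beta>. LINT u : A | chart_measure u\<^sub>0 B. exp (- \<beta> * U_N V \<delta> bc e u))
    \<sim>[at_top] (\<lambda>\<beta>. exp (- \<beta> * U_N V \<delta> bc e u\<^sub>0) * (\<Prod>k\<in>K. sqrt (2 * pi * real CARD('n) / (\<beta> * l k))))"
proof -
  note basis = eigenbasis[OF e \<phi> l, folded B_def]
  define q where "q w = chain_form V \<delta> bc e u\<^sub>0 w w / 2" for w
  have q_unit: "q (\<phi> k /\<^sub>R norm (\<phi> k)) = l k / (2 * real CARD('n))" if "k \<in> K" for k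
    using basis(3)[OF that] by (simp add: q_def)
  obtain a d where a: "0 < a" "\<And>u :: real^'n. a * (norm u)\<^sup>2 - d \<le> U_N V \<delta> bc e u"
    using U_N_lower_bound[OF e V] by metis
  have "(\<lambda>\<beta>. LINT u : A | chart_measure u\<^sub>0 B. exp (- \<beta> * U_N V \<delta> bc e u))
      \<sim>[at_top] (\<lambda>\<beta>. exp (- \<beta> * U_N V \<delta> bc e u\<^sub>0) * (\<Prod>b\<in>B. sqrt (pi / (\<beta> * q b))))"
  proof (rule laplace[OF basis(2) U_N_measurable[OF V]])
    show "q (\<Sum>b\<in>B. x b *\<^sub>R b) = (\<Sum>b\<in>B. (x b)\<^sup>2 * q b)" for x
      using chain_form_eigenbasis_sum[OF e fin \<phi> l, folded B_def, of x] by (simp add: q_def sum_divide_distrib)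
    show "0 < q b" if "b \<in> B" for b
      using that l_pos q_unit by (auto simp: B_def)
    show "\<forall>\<^sub>F w in nhds 0. \<bar>U_N V \<delta> bc e (u\<^sub>0 + w) - U_N V \<delta> bc e u\<^sub>0 - q w\<bar> \<le> \<eta> * (norm w)\<^sup>2"
      if "0 < \<eta>" for \<eta>
      unfolding q_def by (rule U_N_expansion[OF e V crit that])
    show "integrable (chart_measure u\<^sub>0 B) (\<lambda>u. exp (- \<beta> * U_N V \<delta> bc e u))" if "0 < \<beta>" for \<beta>
      by (rule chart_integrable_exp[OF basis(2) U_N_measurable[OF V] a that])
  qed (use A conc in auto)
  moreover have "(\<Prod>b\<in>B. sqrt (pi / (\<beta> * q b))) = (\<Prod>k\<in>K. sqrt (2 * pi * real CARD('n) / (\<beta> * l k)))" for \<beta>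
    unfolding B_def by (subst prod.reindex[OF basis(1)]) (auto simp: q_unit mult_ac intro!: prod.cong)
  ultimately show ?thesis by simp
qed

text \<open>Dimension count: N orthonormal vectors fill the space, and the N - 1 of them that are
  orthogonal to \<open>\<phi> 1\<close> fill its orthogonal complement.\<close>

lemma span_eigenbasis:
  fixes \<phi> :: "nat \<Rightarrow> real^'n"
  assumes e: "bij_betw e {1..CARD('n)} UNIV"
    and \<phi>: "\<forall>k\<in>{1..CARD('n)}. eigenpair V \<delta> bc e u (l k) (\<phi> k)"
    and l: "strict_mono_on {1..CARD('n)} l"
  defines "b \<equiv> \<lambda>k. \<phi> k /\<^sub>R norm (\<phi> k)"
  shows "span (b ` {1..CARD('n)}) = UNIV" and "span (b ` {2..CARD('n)}) = {w. w \<bullet> \<phi> 1 = 0}"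
proof -
  let ?N = "CARD('n)"
  have N: "1 \<in> {1..?N}" by (simp add: Suc_leI)
  have l2: "strict_mono_on {2..?N} l" using l by (auto simp: strict_mono_on_def)
  note b1 = eigenbasis[OF e \<phi> l, folded b_def]
  have "\<forall>k\<in>{2..?N}. eigenpair V \<delta> bc e u (l k) (\<phi> k)"
    using \<phi> by auto
  note b2 = eigenbasis[OF e this l2, folded b_def]
  have "dim (span (b ` {1..?N})) = ?N"
    using orthonormal_basis_of_finite(2)[OF b1(2)] card_image[OF b1(1)] by simp
  then show "span (b ` {1..?N}) = UNIV"
    by (intro subspace_dim_equal) auto
  have nz: "\<phi> 1 \<noteq> 0" using bspec[OF \<phi> N] by (simp add: eigenpair_def)
  have "l k \<noteq> l 1" if "k \<in> {2..?N}" for k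
    using strict_mono_onD[OF l N, of k] that by auto
  then have "\<phi> 1 \<bullet> b k = 0" if "k \<in> {2..?N}" for k
    using eigenpair_orthogonal[OF e bspec[OF \<phi> N] bspec[OF \<phi>], of k] that by (fastforce simp: b_def)
  then have sub: "span (b ` {2..?N}) \<subseteq> {w. \<phi> 1 \<bullet> w = 0}"
    by (intro span_minimal) (auto simp: subspace_hyperplane)
  have "dim (span (b ` {2..?N})) = ?N - 1"
    using orthonormal_basis_of_finite(2)[OF b2(2)] card_image[OF b2(1)] by simp
  then have "span (b ` {2..?N}) = {w. \<phi> 1 \<bullet> w = 0}"
    using sub dim_hyperplane[OF nz] by (intro subspace_dim_equal) (auto simp: subspace_hyperplane)
  then show "span (b ` {2..?N}) = {w. w \<bullet> \<phi> 1 = 0}" by (simp add: inner_commute)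
qed

section \<open>Splitting of phase space and the final constants\<close>

lemma directions_hyperplane: "directions (hyperplane us \<phi>) = {w. w \<bullet> \<phi> = 0}"
proof (intro equalityI subsetI)
  fix w assume "w \<in> {w. w \<bullet> \<phi> = 0}"
  then have "us + w \<in> hyperplane us \<phi>" "us \<in> hyperplane us \<phi>" by (auto simp: hyperplane_def)
  then show "w \<in> directions (hyperplane us \<phi>)"
    unfolding directions_def by (intro CollectI exI[of _ "us + w"] exI[of _ us]) simp
qed (auto simp: directions_def hyperplane_def inner_diff_left)

lemma directions_dividing_surface: "directions (dividing_surface us \<phi>) = UNIV \<times> {w. w \<bullet> \<phi> = 0}"
proof (intro equalityI subsetI)
  fix z :: "(real^'a) \<times> (real^'a)" assume "z \<in> UNIV \<times> {w. w \<bullet> \<phi> = 0}"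
  then have "(0, us) + z \<in> dividing_surface us \<phi>" "(0, us) \<in> dividing_surface us \<phi>"
    by (auto simp: dividing_surface_def)
  then show "z \<in> directions (dividing_surface us \<phi>)"
    unfolding directions_def by (intro CollectI exI[of _ "(0, us) + z"] exI[of _ "(0, us)"]) simp
qed (auto simp: directions_def dividing_surface_def inner_diff_left)

lemma H_N_eq:
  fixes z :: "(real^'n) \<times> (real^'n)"
  assumes e: "bij_betw e {1..CARD('n)} UNIV"
  shows "H_N V \<delta> bc e z = (norm (fst z))\<^sup>2 / (2 * real CARD('n)) + U_N V \<delta> bc e (snd z)"
  using site_sum_eq_norm[OF e, of bc "fst z"] by (simp add: H_N_def site_def)

text \<open>For an odd-dimensional sphere the Gamma argument is an integer, so Gamma is a factorial.
  It cancels the factorial in the asymptotic formulas.\<close>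

lemma sphere_area_odd: "sphere_area (2 * m + 1) = 2 * pi ^ (m + 1) / fact m"
proof -
  have "(real (2 * m + 1) + 1) / 2 = real (m + 1)" by simp
  then show ?thesis
    unfolding sphere_area_def using Gamma_fact[of m, where 'a=real]
    by (simp only: powr_realpow[OF pi_gt_zero]) (simp add: add.commute)
qed

text \<open>The region restricts only the position, so the momentum integral is the full Gaussian
  \<open>sqrt (2 pi N / \<beta>) ^ N\<close>. The minimizer lies strictly inside the open half
  space, hence so does a small ball around it.\<close>

lemma region_integral:
  fixes u\<^sub>0 us v :: "real^'n" and \<phi> :: "nat \<Rightarrow> real^'n"
  assumes e: "bij_betw e {1..CARD('n)} UNIV" and V: "double_well V"
    and min: "local_minimizer (U_N V \<delta> bc e) u\<^sub>0" and mem: "(0, u\<^sub>0) \<in> region s us v"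
    and \<phi>: "\<forall>k\<in>{1..CARD('n)}. eigenpair V \<delta> bc e u\<^sub>0 (l k) (\<phi> k)"
    and l: "strict_mono_on {1..CARD('n)} l" and l1: "0 < l 1"
    and conc: "concentrated_near lborel (half_space s us v) (U_N V \<delta> bc e) u\<^sub>0"
  shows "(\<lambda>\<beta>. LINT z : region s us v | lborel. exp (- \<beta> * H_N V \<delta> bc e z))
    \<sim>[at_top]
      (\<lambda>\<beta>. 2 ^ (CARD('n) - 1) * real CARD('n) ^ CARD('n) * fact (CARD('n) - 1) * sphere_area (2 * CARD('n) - 1)
             / (\<beta> ^ CARD('n) * (\<Prod>j=1..CARD('n). sqrt (l j))) * exp (- \<beta> * U_N V \<delta> bc e u\<^sub>0))"
proof -
  let ?N = "CARD('n)" and ?U = "U_N V \<delta> bc e"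
  have N: "1 \<in> {1..?N}" by (simp add: Suc_leI)
  have l_pos: "\<forall>k\<in>{1..?N}. 0 < l k"
  proof
    fix k assume "k \<in> {1..?N}"
    then show "0 < l k" using l1 strict_mono_onD[OF l N, of k] by (cases "k = 1") auto
  qed
  note [measurable] = U_N_measurable[OF V, of \<delta> bc e]
  define B where "B = (\<lambda>k. \<phi> k /\<^sub>R norm (\<phi> k)) ` {1..?N}"
  have B: "orthonormal_basis_of UNIV B"
    using eigenbasis(2)[OF e \<phi> l] span_eigenbasis(1)[OF e \<phi> l] by (simp add: B_def)
  have "open (half_space s us v)"
    unfolding half_space_def by (intro open_Collect_less continuous_intros)
  then have A: "half_space s us v \<in> sets borel" "\<forall>\<^sub>F w in nhds 0. u\<^sub>0 + w \<in> half_space s us v"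
  proof -
    assume op: "open (half_space s us v)"
    show "half_space s us v \<in> sets borel" using op by simp
    have "u\<^sub>0 \<in> half_space s us v" using mem by (simp add: region_def half_space_def)
    moreover have "filterlim (\<lambda>w. u\<^sub>0 + w) (nhds (u\<^sub>0 + 0)) (nhds 0)"
      by (rule tendsto_add[OF tendsto_const filterlim_ident])
    ultimately show "\<forall>\<^sub>F w in nhds 0. u\<^sub>0 + w \<in> half_space s us v"
      using op by (auto elim!: topological_tendstoD)
  qed
  from A(2) have "\<forall>\<^sub>F w in nhds 0. w \<in> span B \<longrightarrow> u\<^sub>0 + w \<in> half_space s us v"
    by eventually_elim simp
  then have "(\<lambda>\<beta>. LINT u : half_space s us v | lborel. exp (- \<beta> * ?U u))
      \<sim>[at_top] (\<lambda>\<beta>. exp (- \<beta> * ?U u\<^sub>0) * (\<Prod>k=1..?N. sqrt (2 * pi * real ?N / (\<beta> * l k))))"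
    using laplace_chain[OF e V local_minimizer_critical[OF V min] _ \<phi> l l_pos, of "half_space s us v"] conc A(1)
    unfolding B_def[symmetric] chart_measure_UNIV[OF B] by simp
  then have "(\<lambda>\<beta>. sqrt (2 * pi * real ?N / \<beta>) ^ ?N * (LINT u : half_space s us v | lborel. exp (- \<beta> * ?U u)))
      \<sim>[at_top] (\<lambda>\<beta>. sqrt (2 * pi * real ?N / \<beta>) ^ ?N *
        (exp (- \<beta> * ?U u\<^sub>0) * (\<Prod>k=1..?N. sqrt (2 * pi * real ?N / (\<beta> * l k)))))"
    by (intro asymp_equiv_mult asymp_equiv_refl)
  then show ?thesis
  proof (rule asymp_equiv_transfer)
    show "\<forall>\<^sub>F \<beta> in at_top. sqrt (2 * pi * real ?N / \<beta>) ^ ?N * (LINT u : half_space s us v | lborel. exp (- \<beta> * ?U u))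
        = (LINT z : region s us v | lborel. exp (- \<beta> * H_N V \<delta> bc e z))"
      using eventually_gt_at_top[of 0]
    proof eventually_elim
      case (elim \<beta>)
      \<comment> \<open>The standard basis of phase space is a product basis, so the weight factors
        into momentum and position parts.\<close>
      have "(LINT z : region s us v | lborel. exp (- \<beta> * H_N V \<delta> bc e z))
        = (LINT z|chart_measure (0, 0) (Times_basis (Basis :: (real^'n) set) Basis). exp (- (\<beta> / (2 * real ?N) * (norm (fst z))\<^sup>2)) *
            (indicator (half_space s us v) (snd z) * exp (- \<beta> * ?U (snd z))))"
        unfolding set_lebesgue_integral_def Times_basis_Basis chart_measure_UNIV[OF orthonormal_basis_of_Basis] H_N_eq[OF e]
        by (intro Bochner_Integration.integral_cong refl)
          (auto simp: region_def half_space_def indicator_def distrib_left exp_add[symmetric])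
      also have "\<dots> = (LINT p|chart_measure 0 (Basis :: (real^'n) set). exp (- (\<beta> / (2 * real ?N) * (norm p)\<^sup>2))) *
          (LINT u|chart_measure 0 (Basis :: (real^'n) set). indicator (half_space s us v) u * exp (- \<beta> * ?U u))"
        using A by (intro integral_chart_Times) auto
      also have "\<dots> = sqrt (2 * pi * real ?N / \<beta>) ^ ?N * (LINT u : half_space s us v | lborel. exp (- \<beta> * ?U u))"
        unfolding chart_measure_UNIV[OF orthonormal_basis_of_Basis] set_lebesgue_integral_def
        using elim by (subst integral_gauss_euclidean) (auto simp: mult_ac)
      finally show ?case ..
    qed
    show "\<forall>\<^sub>F \<beta> in at_top. sqrt (2 * pi * real ?N / \<beta>) ^ ?N *
          (exp (- \<beta> * ?U u\<^sub>0) * (\<Prod>k=1..?N. sqrt (2 * pi * real ?N / (\<beta> * l k))))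
        = 2 ^ (?N - 1) * real ?N ^ ?N * fact (?N - 1) * sphere_area (2 * ?N - 1)
             / (\<beta> ^ ?N * (\<Prod>j=1..?N. sqrt (l j))) * exp (- \<beta> * ?U u\<^sub>0)"
      using eventually_gt_at_top[of 0]
    proof eventually_elim
      case (elim \<beta>)
      define c where "c = 2 * pi * real ?N / \<beta>"
      have c: "0 < c" using elim by (simp add: c_def)
      obtain m where m: "?N = Suc m" using N by (cases "?N") auto
      have "(\<Prod>k=1..?N. sqrt (2 * pi * real ?N / (\<beta> * l k))) = (\<Prod>k=1..?N. sqrt c / sqrt (l k))"
        by (simp add: c_def real_sqrt_divide[symmetric])
      also have "\<dots> = sqrt c ^ ?N / (\<Prod>k=1..?N. sqrt (l k))"
        by (simp add: prod_dividef)
      finally have 1: "(\<Prod>k=1..?N. sqrt (2 * pi * real ?N / (\<beta> * l k))) = sqrt c ^ ?N / (\<Prod>k=1..?N. sqrt (l k))" .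
      have 2: "sqrt c ^ ?N * sqrt c ^ ?N = (2 * pi * real ?N / \<beta>) ^ ?N"
        using c by (simp add: power_mult_distrib[symmetric]) (simp add: c_def)
      have 3: "sphere_area (2 * ?N - 1) * fact (?N - 1) = 2 * pi ^ ?N"
        using sphere_area_odd[of m] by (simp add: m)
      have 4: "2 ^ (?N - 1) * real ?N ^ ?N * (sphere_area (2 * ?N - 1) * fact (?N - 1)) / \<beta> ^ ?N
          = (2 * pi * real ?N / \<beta>) ^ ?N"
        unfolding 3 by (simp add: m power_mult_distrib power_divide)
      have "sqrt c ^ ?N * (exp (- \<beta> * ?U u\<^sub>0) * (sqrt c ^ ?N / (\<Prod>k=1..?N. sqrt (l k))))
          = (sqrt c ^ ?N * sqrt c ^ ?N) / (\<Prod>k=1..?N. sqrt (l k)) * exp (- \<beta> * ?U u\<^sub>0)"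
        by simp
      also have "\<dots> = 2 ^ (?N - 1) * real ?N ^ ?N * fact (?N - 1) * sphere_area (2 * ?N - 1)
             / (\<beta> ^ ?N * (\<Prod>j=1..?N. sqrt (l j))) * exp (- \<beta> * ?U u\<^sub>0)"
        unfolding 2 4[symmetric] by (simp add: mult_ac)
      finally show ?case unfolding 1 c_def[symmetric] .
    qed
  qed
qed

text \<open>The dividing surface is all momenta times the hyperplane, and its surface measure is the
  corresponding product. The flux depends on the normal momentum alone; the negative direction
  \<open>\<phi> 1\<close> of the saddle is transversal to the surface, so the position integral only
  meets positive eigenvalues.\<close>

lemma surface_integral:
  fixes us :: "real^'n" and \<phi> :: "nat \<Rightarrow> real^'n"
  assumes e: "bij_betw e {1..CARD('n)} UNIV" and V: "double_well V" and N2: "2 \<le> CARD('n)"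
    and crit: "critical_point (U_N V \<delta> bc e) us"
    and \<phi>: "\<forall>k\<in>{1..CARD('n)}. eigenpair V \<delta> bc e us (l k) (\<phi> k)"
    and l: "strict_mono_on {1..CARD('n)} l" and l2: "0 < l 2"
    and conc: "concentrated_near (flat_surface_measure (hyperplane us (\<phi> 1))) (hyperplane us (\<phi> 1)) (U_N V \<delta> bc e) us"
  shows "(\<lambda>\<beta>. LINT z : dividing_surface us (\<phi> 1) | flat_surface_measure (dividing_surface us (\<phi> 1)).
            max (fst z \<bullet> (\<phi> 1 /\<^sub>R norm (\<phi> 1))) 0 * exp (- \<beta> * H_N V \<delta> bc e z))
        \<sim>[at_top]
      (\<lambda>\<beta>. 2 ^ (CARD('n) - 2) * real CARD('n) ^ CARD('n) * fact (CARD('n) - 2) * sphere_area (2 * CARD('n) - 3)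
             / (\<beta> ^ CARD('n) * (\<Prod>j=2..CARD('n). sqrt (l j))) * exp (- \<beta> * U_N V \<delta> bc e us))"
proof -
  let ?N = "CARD('n)" and ?U = "U_N V \<delta> bc e" and ?h = "hyperplane us (\<phi> 1)"
  have N: "1 \<in> {1..?N}" "2 \<in> {1..?N}" using N2 by auto
  have l_pos: "\<forall>k\<in>{2..?N}. 0 < l k"
  proof
    fix k assume "k \<in> {2..?N}"
    then show "0 < l k" using l2 strict_mono_onD[OF l N(2), of k] by (cases "k = 2") auto
  qed
  have l': "strict_mono_on {2..?N} l" using l by (auto simp: strict_mono_on_def)
  have \<phi>': "\<forall>k\<in>{2..?N}. eigenpair V \<delta> bc e us (l k) (\<phi> k)"
    using \<phi> by auto
  note [measurable] = U_N_measurable[OF V, of \<delta> bc e]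
  define n where "n = \<phi> 1 /\<^sub>R norm (\<phi> 1)"
  \<comment> \<open>\<open>B\<close> serves the momenta and contains the normal \<open>n\<close>,
    which isolates the flux coordinate; \<open>C\<close>, without the index 1, serves the positions
    on the hyperplane.\<close>
  define B where "B = (\<lambda>k. \<phi> k /\<^sub>R norm (\<phi> k)) ` {1..?N}"
  define C where "C = (\<lambda>k. \<phi> k /\<^sub>R norm (\<phi> k)) ` {2..?N}"
  have B: "orthonormal_basis_of UNIV B"
    using eigenbasis(2)[OF e \<phi> l] span_eigenbasis(1)[OF e \<phi> l] by (simp add: B_def)
  have span_C: "span C = {w. w \<bullet> \<phi> 1 = 0}"
    using span_eigenbasis(2)[OF e \<phi> l] by (simp add: C_def)
  have C: "orthonormal_basis_of {w. w \<bullet> \<phi> 1 = 0} C"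
    using eigenbasis(2)[OF e \<phi>' l'] span_C by (simp add: C_def)
  have n: "n \<in> B" using N(1) by (auto simp: B_def n_def)
  have "0 \<notin> B" using B by (auto simp: orthonormal_basis_of_def)
  note fin = orthonormal_basis_of_finite(1)[OF B] orthonormal_basis_of_finite(1)[OF C]
  have flat_h: "flat_surface_measure ?h = chart_measure us C"
    by (rule flat_surface_measure_eq) (use C in \<open>auto simp: directions_hyperplane, simp add: hyperplane_def\<close>)
  have flat_S: "flat_surface_measure (dividing_surface us (\<phi> 1)) = chart_measure (0, us) (Times_basis B C)"
    by (rule flat_surface_measure_eq)
      (use orthonormal_basis_of_Times[OF B C] in \<open>auto simp: directions_dividing_surface, simp add: dividing_surface_def\<close>)
  have "closed ?h"
    unfolding hyperplane_def by (intro closed_Collect_eq continuous_intros)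
  then have h: "?h \<in> sets borel" by simp
  have "(\<lambda>\<beta>. LINT u : ?h | chart_measure us C. exp (- \<beta> * ?U u))
      \<sim>[at_top] (\<lambda>\<beta>. exp (- \<beta> * ?U us) * (\<Prod>k=2..?N. sqrt (2 * pi * real ?N / (\<beta> * l k))))"
    using laplace_chain[OF e V crit _ \<phi>' l' l_pos, of ?h] conc h
    unfolding C_def[symmetric] flat_h span_C by (simp add: hyperplane_def)
  then have "(\<lambda>\<beta>. real ?N / \<beta> * sqrt (2 * pi * real ?N / \<beta>) ^ (?N - 1) * (LINT u : ?h | chart_measure us C. exp (- \<beta> * ?U u)))
      \<sim>[at_top] (\<lambda>\<beta>. real ?N / \<beta> * sqrt (2 * pi * real ?N / \<beta>) ^ (?N - 1) *
        (exp (- \<beta> * ?U us) * (\<Prod>k=2..?N. sqrt (2 * pi * real ?N / (\<beta> * l k)))))"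
    by (intro asymp_equiv_mult asymp_equiv_refl)
  then show ?thesis
  proof (rule asymp_equiv_transfer)
    show "\<forall>\<^sub>F \<beta> in at_top. real ?N / \<beta> * sqrt (2 * pi * real ?N / \<beta>) ^ (?N - 1) * (LINT u : ?h | chart_measure us C. exp (- \<beta> * ?U u))
        = (LINT z : dividing_surface us (\<phi> 1) | flat_surface_measure (dividing_surface us (\<phi> 1)).
            max (fst z \<bullet> (\<phi> 1 /\<^sub>R norm (\<phi> 1))) 0 * exp (- \<beta> * H_N V \<delta> bc e z))"
      using eventually_gt_at_top[of 0]
    proof eventually_elim
      case (elim \<beta>)
      have "(LINT z : dividing_surface us (\<phi> 1) | flat_surface_measure (dividing_surface us (\<phi> 1)).
            max (fst z \<bullet> (\<phi> 1 /\<^sub>R norm (\<phi> 1))) 0 * exp (- \<beta> * H_N V \<delta> bc e z))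
        = (LINT z|chart_measure (0, us) (Times_basis B C). (max (fst z \<bullet> n) 0 * exp (- (\<beta> / (2 * real ?N) * (norm (fst z))\<^sup>2))) *
            (indicator ?h (snd z) * exp (- \<beta> * ?U (snd z))))"
        unfolding set_lebesgue_integral_def flat_S H_N_eq[OF e] n_def
        by (intro Bochner_Integration.integral_cong refl)
          (auto simp: dividing_surface_def hyperplane_def indicator_def distrib_left exp_add[symmetric])
      also have "\<dots> = (LINT p|chart_measure 0 B. max (p \<bullet> n) 0 * exp (- (\<beta> / (2 * real ?N) * (norm p)\<^sup>2))) *
          (LINT u|chart_measure us C. indicator ?h u * exp (- \<beta> * ?U u))"
        using h fin \<open>0 \<notin> B\<close> by (intro integral_chart_Times) auto
      also have "(LINT p|chart_measure 0 B. max (p \<bullet> n) 0 * exp (- (\<beta> / (2 * real ?N) * (norm p)\<^sup>2)))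
          = real ?N / \<beta> * sqrt (2 * pi * real ?N / \<beta>) ^ (?N - 1)"
        unfolding chart_measure_UNIV[OF B]
        using elim by (subst integral_half_gauss_euclidean[OF _ B n]) (auto simp: mult_ac)
      finally show ?case unfolding set_lebesgue_integral_def by simp
    qed
    show "\<forall>\<^sub>F \<beta> in at_top. real ?N / \<beta> * sqrt (2 * pi * real ?N / \<beta>) ^ (?N - 1) *
          (exp (- \<beta> * ?U us) * (\<Prod>k=2..?N. sqrt (2 * pi * real ?N / (\<beta> * l k))))
        = 2 ^ (?N - 2) * real ?N ^ ?N * fact (?N - 2) * sphere_area (2 * ?N - 3)
             / (\<beta> ^ ?N * (\<Prod>j=2..?N. sqrt (l j))) * exp (- \<beta> * ?U us)"
      using eventually_gt_at_top[of 0]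
    proof eventually_elim
      case (elim \<beta>)
      define c where "c = 2 * pi * real ?N / \<beta>"
      have c: "0 < c" using elim by (simp add: c_def)
      obtain m where m: "?N = Suc (Suc m)" using N2 by (metis Suc_le_D numeral_2_eq_2 Suc_le_mono)
      have "(\<Prod>k=2..?N. sqrt (2 * pi * real ?N / (\<beta> * l k))) = (\<Prod>k=2..?N. sqrt c / sqrt (l k))"
        by (simp add: c_def real_sqrt_divide[symmetric])
      also have "\<dots> = sqrt c ^ (?N - 1) / (\<Prod>k=2..?N. sqrt (l k))"
        by (simp add: prod_dividef)
      finally have 1: "(\<Prod>k=2..?N. sqrt (2 * pi * real ?N / (\<beta> * l k))) = sqrt c ^ (?N - 1) / (\<Prod>k=2..?N. sqrt (l k))" .
      have 2: "sqrt c ^ (?N - 1) * sqrt c ^ (?N - 1) = (2 * pi * real ?N / \<beta>) ^ (?N - 1)"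
        using c by (simp add: power_mult_distrib[symmetric]) (simp add: c_def)
      \<comment> \<open>With \<open>N = m + 2\<close> the truncated subtractions are exact:
        \<open>2 * N - 3 = 2 * m + 1\<close> and \<open>N - 2 = m\<close>.\<close>
      have 3: "sphere_area (2 * ?N - 3) * fact (?N - 2) = 2 * pi ^ (?N - 1)"
        using sphere_area_odd[of m] by (simp add: m)
      have 4: "2 ^ (?N - 2) * real ?N ^ ?N * (sphere_area (2 * ?N - 3) * fact (?N - 2)) / \<beta> ^ ?N
          = real ?N / \<beta> * (2 * pi * real ?N / \<beta>) ^ (?N - 1)"
        unfolding 3 by (simp add: m power_mult_distrib power_divide)
      have "real ?N / \<beta> * sqrt c ^ (?N - 1) * (exp (- \<beta> * ?U us) * (sqrt c ^ (?N - 1) / (\<Prod>k=2..?N. sqrt (l k))))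
          = real ?N / \<beta> * (sqrt c ^ (?N - 1) * sqrt c ^ (?N - 1)) / (\<Prod>k=2..?N. sqrt (l k)) * exp (- \<beta> * ?U us)"
        by simp
      also have "\<dots> = 2 ^ (?N - 2) * real ?N ^ ?N * fact (?N - 2) * sphere_area (2 * ?N - 3)
             / (\<beta> ^ ?N * (\<Prod>j=2..?N. sqrt (l j))) * exp (- \<beta> * ?U us)"
        unfolding 2 4[symmetric] by (simp add: mult_ac)
      finally show ?case unfolding 1 c_def[symmetric] .
    qed
  qed
qed

theorem proposition3:
  fixes V :: "real \<Rightarrow> real" and \<delta> :: real and bc :: boundary
    and e :: "nat \<Rightarrow> 'n::finite"
    and us up um :: "real^'n"
    and ls lp lm :: "nat \<Rightarrow> real"
    and \<phi> \<psi>p \<psi>m :: "nat \<Rightarrow> real^'n"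
    and N :: nat
  defines "N \<equiv> CARD('n)"
  defines "U \<equiv> U_N V \<delta> bc e" and "H \<equiv> H_N V \<delta> bc e"
  assumes "N \<ge> 2" and e: "bij_betw e {1..N} UNIV"
    and "\<delta> > 0" and "double_well V"
    and saddle: "critical_point U us" "morse_index U us = 1"
      "\<And>v. critical_point U v \<Longrightarrow> morse_index U v = 1 \<Longrightarrow> U us \<le> U v"
    and saddle_eigen: "\<And>k. k \<in> {1..N} \<Longrightarrow> eigenpair V \<delta> bc e us (ls k) (\<phi> k)"
      "strict_mono_on {1..N} ls" "ls 1 < 0" "0 < ls 2"
    and minimizers: "{u. local_minimizer U u} = {up, um}"
      "(0, up) \<in> region 1 us (\<phi> 1)" "(0, um) \<in> region (-1) us (\<phi> 1)"
    and plus_eigen: "\<And>k. k \<in> {1..N} \<Longrightarrow> eigenpair V \<delta> bc e up (lp k) (\<psi>p k)"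
      "strict_mono_on {1..N} lp" "0 < lp 1"
    and minus_eigen: "\<And>k. k \<in> {1..N} \<Longrightarrow> eigenpair V \<delta> bc e um (lm k) (\<psi>m k)"
      "strict_mono_on {1..N} lm" "0 < lm 1"
    and concentration:
      "concentrated_near (flat_surface_measure (hyperplane us (\<phi> 1))) (hyperplane us (\<phi> 1)) U us"
      "concentrated_near lborel (half_space 1 us (\<phi> 1)) U up"
      "concentrated_near lborel (half_space (-1) us (\<phi> 1)) U um"
  shows
    "((\<lambda>\<beta>. LINT z : dividing_surface us (\<phi> 1) | flat_surface_measure (dividing_surface us (\<phi> 1)).
            max (fst z \<bullet> (\<phi> 1 /\<^sub>R norm (\<phi> 1))) 0 * exp (- \<beta> * H z))
        \<sim>[at_top]
      (\<lambda>\<beta>. 2 ^ (N - 2) * real N ^ N * fact (N - 2) * sphere_area (2 * N - 3)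
             / (\<beta> ^ N * (\<Prod>j=2..N. sqrt (ls j))) * exp (- \<beta> * U us))) \<and>
     ((\<lambda>\<beta>. LINT z : region 1 us (\<phi> 1) | lborel. exp (- \<beta> * H z))
        \<sim>[at_top]
      (\<lambda>\<beta>. 2 ^ (N - 1) * real N ^ N * fact (N - 1) * sphere_area (2 * N - 1)
             / (\<beta> ^ N * (\<Prod>j=1..N. sqrt (lp j))) * exp (- \<beta> * U up))) \<and>
     ((\<lambda>\<beta>. LINT z : region (-1) us (\<phi> 1) | lborel. exp (- \<beta> * H z))
        \<sim>[at_top]
      (\<lambda>\<beta>. 2 ^ (N - 1) * real N ^ N * fact (N - 1) * sphere_area (2 * N - 1)
             / (\<beta> ^ N * (\<Prod>j=1..N. sqrt (lm j))) * exp (- \<beta> * U um)))"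
proof -
  have e': "bij_betw e {1..CARD('n)} UNIV" using e by (simp add: N_def)
  \<comment> \<open>Local minimality makes both points critical, so that the energy has a
    second-order expansion without linear term there.\<close>
  have min: "local_minimizer U up" "local_minimizer U um" using minimizers(1) by auto
  show ?thesis
    unfolding U_def H_def
  proof (intro conjI)
    show "(\<lambda>\<beta>. LINT z : dividing_surface us (\<phi> 1) | flat_surface_measure (dividing_surface us (\<phi> 1)).
            max (fst z \<bullet> (\<phi> 1 /\<^sub>R norm (\<phi> 1))) 0 * exp (- \<beta> * H_N V \<delta> bc e z))
        \<sim>[at_top]
      (\<lambda>\<beta>. 2 ^ (N - 2) * real N ^ N * fact (N - 2) * sphere_area (2 * N - 3)
             / (\<beta> ^ N * (\<Prod>j=2..N. sqrt (ls j))) * exp (- \<beta> * U_N V \<delta> bc e us))"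
      unfolding N_def
      by (rule surface_integral[OF e' \<open>double_well V\<close>])
        (use assms(4) saddle(1) saddle_eigen concentration(1) in \<open>simp_all add: N_def U_def\<close>)
    show "(\<lambda>\<beta>. LINT z : region 1 us (\<phi> 1) | lborel. exp (- \<beta> * H_N V \<delta> bc e z))
        \<sim>[at_top]
      (\<lambda>\<beta>. 2 ^ (N - 1) * real N ^ N * fact (N - 1) * sphere_area (2 * N - 1)
             / (\<beta> ^ N * (\<Prod>j=1..N. sqrt (lp j))) * exp (- \<beta> * U_N V \<delta> bc e up))"
      unfolding N_def
      by (rule region_integral[OF e' \<open>double_well V\<close> min(1)[unfolded U_def] minimizers(2), of lp \<psi>p])
        (use plus_eigen concentration(2) in \<open>simp_all add: N_def U_def\<close>)
    show "(\<lambda>\<beta>. LINT z : region (-1) us (\<phi> 1) | lborel. exp (- \<beta> * H_N V \<delta> bc e z))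
        \<sim>[at_top]
      (\<lambda>\<beta>. 2 ^ (N - 1) * real N ^ N * fact (N - 1) * sphere_area (2 * N - 1)
             / (\<beta> ^ N * (\<Prod>j=1..N. sqrt (lm j))) * exp (- \<beta> * U_N V \<delta> bc e um))"
      unfolding N_def
      by (rule region_integral[OF e' \<open>double_well V\<close> min(2)[unfolded U_def] minimizers(3), of lm \<psi>m])
        (use minus_eigen concentration(3) in \<open>simp_all add: N_def U_def\<close>)
  qed
qed

end
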